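(* Let $K$ be a field, let $n_1<n_2<n_3<n_4$ be positive integers with $\gcd(n_1,n_2,n_3,n_4)=1$, and let $C$ be the monomial curve $x_i=t^{n_i}$ ($1\le i\le 4$) in $\mathbb{A}^4(K)$. Suppose that $a_in_i\neq a_jn_j$ for all $i\neq j$ (Case 1), and let $$S=\{x_1^{a_1}-\mathbf{x}^{\mathbf{u}},\ x_2^{a_2}-\mathbf{x}^{\mathbf{v}},\ x_3^{a_3}-\mathbf{x}^{\mathbf{w}},\ x_4^{a_4}-\mathbf{x}^{\mathbf{z}}\}$$ be a generating set of the critical ideal $\mathcal{C}_A$ consisting of critical binomials with respect to $x_1,x_2,x_3,x_4$ respectively. Assume that $1\notin\mathrm{supp}(\mathbf{x}^{\mathbf{v}})$. Then in each of the following cases $C$ has Cohen-Macaulay tangent cone at the origin. (i) $1\in\mathrm{supp}(\mathbf{x}^{\mathbf{w}})$, $1\in\mathrm{supp}(\mathbf{x}^{\mathbf{z}})$ and (1) $a_3\le\deg(\mathbf{x}^{\mathbf{w}})$, (2) for every binomial $f=M-N\in\mathcal{I}$ with $1\in\mathrm{supp}(M)$ we have $\deg(N)\le\deg(M)$, and (3) for every monomial $M=x_2^{d_2}x_3^{d_3}x_4^{d_4}$ with $d_2\ge a_2$, $d_3<a_3$, $d_4<a_4$ and $d_2n_2+d_3n_3+d_4n_4\in n_1+\mathcal{S}$ there exists a monomial $N$ with $1\in\mathrm{supp}(N)$ such that $M-N\in I(C)$ and $\deg(M)\le\deg(N)$. (ii) $1\in\mathrm{supp}(\mathbf{x}^{\mathbf{w}})$,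 $1\notin\mathrm{supp}(\mathbf{x}^{\mathbf{z}})$ and (1) $a_3\le\deg(\mathbf{x}^{\mathbf{w}})$, and (2) for every monomial $M=x_2^{d_2}x_3^{d_3}x_4^{d_4}$ with $d_3<a_3$ and $d_2n_2+d_3n_3+d_4n_4\in n_1+\mathcal{S}$ there exists a monomial $N$ with $1\in\mathrm{supp}(N)$ such that $M-N\in I(C)$ and $\deg(M)\le\deg(N)$. (iii) $1\notin\mathrm{supp}(\mathbf{x}^{\mathbf{w}})$, $1\in\mathrm{supp}(\mathbf{x}^{\mathbf{z}})$ and for every monomial $M=x_2^{d_2}x_3^{d_3}x_4^{d_4}$ with $d_4<a_4$ and $d_2n_2+d_3n_3+d_4n_4\in n_1+\mathcal{S}$ there exists a monomial $N$ with $1\in\mathrm{supp}(N)$ such that $M-N\in I(C)$ and $\deg(M)\le\deg(N)$.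
   Context: $\mathbb{N}$ denotes the non-negative integers, and all exponents $d_i$ are in $\mathbb{N}$. $A=\{n_1,\dots,n_4\}$; $\mathcal{S}=\{g_1n_1+\cdots+g_4n_4 : g_i\in\mathbb{N}\}$; $n_1+\mathcal{S}=\{n_1+m: m\in\mathcal{S}\}$. $I(C)$ is the kernel of the $K$-algebra homomorphism $K[x_1,\dots,x_4]\to K[t]$, $x_i\mapsto t^{n_i}$. For a monomial $\mathbf{x}^{\mathbf{u}}=x_1^{u_1}\cdots x_4^{u_4}$, $\deg(\mathbf{x}^{\mathbf{u}})=u_1+\cdots+u_4$ and $\mathrm{supp}(\mathbf{x}^{\mathbf{u}})=\{i: x_i\mid\mathbf{x}^{\mathbf{u}}\}$. $C$ has Cohen-Macaulay tangent cone at the origin if the ring $K[x_1,\dots,x_4]/I(C)_*$ is Cohen-Macaulay, where $I(C)_*$ is generated by the homogeneous (standard grading) summands $f_*$ of least degree of the polynomials $f\in I(C)$. For each $i$, $a_i$ is the least positive integer such that $a_in_i\in\sum_{j\neq i}\mathbb{N}n_j$; a binomial $x_i^{a_i}-\prod_{j\ne i}x_j^{u_{ij}}\in I(C)$ is called critical with respect to $x_i$, and the critical ideal $\mathcal{C}_A$ is the ideal of $K[x_1,\dots,x_4]$ generated by all critical binomials of $I(C)$. In Case 1 ($a_in_i\neq a_jn_j$ for all $i\ne j$), $\mathcal{C}_A$ is minimally generated by such a set $S$, where each of the monomials $\mathbf{x}^{\mathbf{u}},\mathbf{x}^{\mathbf{v}},\mathbf{x}^{\mathbf{w}},\mathbf{x}^{\mathbf{z}}$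 has support of cardinality at least two, and $S\cup\mathcal{I}$ is a minimal generating system of $I(C)$ (a theorem of Katsabekis and Ojeda), where $\mathcal{I}$ is the set of all binomials (taken up to sign) $x_{i_1}^{u_{i_1}}x_{i_2}^{u_{i_2}}-x_{i_3}^{u_{i_3}}x_{i_4}^{u_{i_4}}\in I(C)$ with $\{i_1,i_2,i_3,i_4\}=\{1,2,3,4\}$, $0<u_{i_j}<a_{i_j}$ for $j=1,2$, $u_{i_3}>0$, $u_{i_4}>0$, and $x_{i_3}^{u_{i_3}}x_{i_4}^{u_{i_4}}$ an indispensable monomial. A monomial is indispensable if every system of binomial generators of $I(C)$ contains a binomial having that monomial as one of its two terms. *)

theory Defs
  imports
    "HOL-Library.Poly_Mapping"
    "HOL-Library.Extended_Nat"
    "HOL-Algebra.Ring_Divisibility"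
    "HOL-Algebra.Algebraic_Closure_Type"
begin

section \<open>Cohen-Macaulay rings\<close>

text \<open>The condition on \<open>xs ! i\<close> says that it is a non-zero-divisor on the quotient of \<open>R\<close> by
  the ideal generated by the preceding elements.\<close>

definition regular_sequence :: "('a, 'b) ring_scheme \<Rightarrow> 'a list \<Rightarrow> bool" where
  "regular_sequence R xs \<longleftrightarrow>
     set xs \<subseteq> carrier R \<and> genideal R (set xs) \<noteq> carrier R \<and>
     (\<forall>i < length xs. \<forall>y \<in> carrier R.
        (xs ! i) \<otimes>\<^bsub>R\<^esub> y \<in> genideal R (set (take i xs)) \<longrightarrow> y \<in> genideal R (set (take i xs)))"

definition ideal_depth :: "('a, 'b) ring_scheme \<Rightarrow> 'a set \<Rightarrow> enat" where
  "ideal_depth R I = Sup {enat (length xs) | xs. regular_sequence R xs \<and> set xs \<subseteq> I}"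

definition prime_height :: "('a, 'b) ring_scheme \<Rightarrow> 'a set \<Rightarrow> enat" where
  "prime_height R P = Sup {enat k | k Q. (\<forall>i \<le> k. primeideal (Q i) R) \<and>
                                        (\<forall>i < k. Q i \<subset> Q (Suc i)) \<and> Q k = P}"

text \<open>The definition of Eisenbud, \<^emph>\<open>Commutative Algebra\<close>, Section 18.2. Depth and height of
  a maximal ideal \<open>P\<close> of a Noetherian ring are those of the local ring at \<open>P\<close>, so no
  localization is needed.\<close>

definition cohen_macaulay_ring :: "('a, 'b) ring_scheme \<Rightarrow> bool" where
  "cohen_macaulay_ring R \<longleftrightarrow> cring R \<and> noetherian_ring R \<and>
     (\<forall>P. maximalideal P R \<longrightarrow> ideal_depth R P = prime_height R P)"


section \<open>The polynomial ring in four variables\<close>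

datatype var = X1 | X2 | X3 | X4

lemma UNIV_var: "(UNIV :: var set) = {X1, X2, X3, X4}"
  using var.exhaust by auto

instance var :: finite
  by standard (simp add: UNIV_var)

text \<open>A monomial is represented by its exponent vector, of type \<open>mon\<close>. So
  \<^term>\<open>Poly_Mapping.keys\<close> gives the support of a monomial, but the set of monomials that
  occur in a polynomial.\<close>

type_synonym mon = "var \<Rightarrow>\<^sub>0 nat"
type_synonym 'k pol = "mon \<Rightarrow>\<^sub>0 'k"

abbreviation supp :: "mon \<Rightarrow> var set" where
  "supp u \<equiv> Poly_Mapping.keys u"

abbreviation xpow :: "var \<Rightarrow> nat \<Rightarrow> mon" where
  "xpow i a \<equiv> Poly_Mapping.single i a"

abbreviation mono_pol :: "mon \<Rightarrow> 'k::comm_ring_1 pol" where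
  "mono_pol u \<equiv> Poly_Mapping.single u 1"

abbreviation pol_ring :: "'k::field pol ring" where
  "pol_ring \<equiv> ring_of_type_algebra"

definition mdeg :: "mon \<Rightarrow> nat" where
  "mdeg u = (\<Sum>i\<in>UNIV. Poly_Mapping.lookup u i)"


section \<open>Initial forms and tangent cones at the origin\<close>

definition least_degree :: "'k::field pol \<Rightarrow> nat" where
  "least_degree f = Min (mdeg ` Poly_Mapping.keys f)"

text \<open>For \<open>f = 0\<close> the sum is empty and the value is \<open>0\<close>.\<close>

definition initial_form :: "'k::field pol \<Rightarrow> 'k pol" where
  "initial_form f =
     (\<Sum>u \<in> {u \<in> Poly_Mapping.keys f. mdeg u = least_degree f}.
        Poly_Mapping.single u (Poly_Mapping.lookup f u))"

definition initial_ideal :: "'k::field pol set \<Rightarrow> 'k pol set" where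
  "initial_ideal I = genideal pol_ring (initial_form ` I)"


section \<open>Monomial curves\<close>

text \<open>Here \<^term>\<open>n :: var \<Rightarrow> nat\<close> is the sequence of exponents of the parametrization; the argument of
  type \<^typ>\<open>'k itself\<close> only carries the ground field.\<close>

definition semigrp :: "(var \<Rightarrow> nat) \<Rightarrow> nat set" where
  "semigrp n = {\<Sum>i\<in>UNIV. g i * n i | g. True}"

definition param_map :: "(var \<Rightarrow> nat) \<Rightarrow> 'k::field pol \<Rightarrow> 'k poly" where
  "param_map n f =
     (\<Sum>u \<in> Poly_Mapping.keys f.
        [:Poly_Mapping.lookup f u:] * (\<Prod>i\<in>UNIV. (Polynomial.monom 1 (n i)) ^ Poly_Mapping.lookup u i))"

definition curve_ideal :: "'k::field itself \<Rightarrow> (var \<Rightarrow> nat) \<Rightarrow> 'k pol set" where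
  "curve_ideal K n = {f. param_map n f = 0}"

definition has_CM_tangent_cone :: "'k::field itself \<Rightarrow> (var \<Rightarrow> nat) \<Rightarrow> bool" where
  "has_CM_tangent_cone K n \<longleftrightarrow>
     cohen_macaulay_ring (pol_ring Quot initial_ideal (curve_ideal K n))"

text \<open>The \<open>a\<^sub>i\<close>.\<close>

definition crit_exp :: "(var \<Rightarrow> nat) \<Rightarrow> var \<Rightarrow> nat" where
  "crit_exp n i = (LEAST a. 0 < a \<and> (\<exists>g. a * n i = (\<Sum>j \<in> UNIV - {i}. g j * n j)))"

definition critical_binomial :: "(var \<Rightarrow> nat) \<Rightarrow> var \<Rightarrow> 'k::field pol \<Rightarrow> bool" where
  "critical_binomial n i f \<longleftrightarrow>
     (\<exists>u. i \<notin> supp u \<and> f = mono_pol (xpow i (crit_exp n i)) - mono_pol u) \<and>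
     f \<in> curve_ideal TYPE('k) n"

definition critical_ideal :: "'k::field itself \<Rightarrow> (var \<Rightarrow> nat) \<Rightarrow> 'k pol set" where
  "critical_ideal K n = genideal pol_ring {f. \<exists>i. critical_binomial n i f}"

text \<open>The two terms of a binomial are distinct, so they are exactly its \<^const>\<open>Poly_Mapping.keys\<close>;
  in particular \<open>0\<close> is not a binomial.\<close>

definition is_binomial :: "'k::field pol \<Rightarrow> bool" where
  "is_binomial f \<longleftrightarrow> (\<exists>u v. u \<noteq> v \<and> f = mono_pol u - mono_pol v)"

definition indispensable :: "'k::field itself \<Rightarrow> (var \<Rightarrow> nat) \<Rightarrow> mon \<Rightarrow> bool" where
  "indispensable K n u \<longleftrightarrow>
     (\<forall>B :: 'k pol set. (\<forall>f \<in> B. is_binomial f) \<and> genideal pol_ring B = curve_ideal K n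
        \<longrightarrow> (\<exists>f \<in> B. u \<in> Poly_Mapping.keys f))"

text \<open>The set \<open>\<I>\<close>. Its elements are only defined up to sign, hence both signs are included.\<close>

definition indisp_binomials :: "'k::field itself \<Rightarrow> (var \<Rightarrow> nat) \<Rightarrow> 'k pol set" where
  "indisp_binomials K n =
     {f. \<exists>i1 i2 i3 i4 c1 c2 c3 c4 u v.
        {i1, i2, i3, i4} = UNIV \<and>
        u = xpow i1 c1 + xpow i2 c2 \<and>
        v = xpow i3 c3 + xpow i4 c4 \<and>
        0 < c1 \<and> c1 < crit_exp n i1 \<and> 0 < c2 \<and> c2 < crit_exp n i2 \<and> 0 < c3 \<and> 0 < c4 \<and>
        indispensable K n v \<and>
        f \<in> curve_ideal K n \<and>
        (f = mono_pol u - mono_pol v \<or> f = mono_pol v - mono_pol u)}"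

end

theory Submission
  imports Defs
begin

text \<open>
  Give the monomial \<open>x\<^sup>u\<close> the weight \<open>u\<^sub>1 n\<^sub>1 + \<dots> + u\<^sub>4 n\<^sub>4\<close>, so that a polynomial lies in \<open>I(C)\<close> iff its
  coefficients add up to zero over every fibre of the weight. Passing to initial forms retains from
  each fibre only the monomials of greatest degree: \<open>I(C)\<^sub>*\<close> consists of the polynomials whose
  coefficients add up to zero over the monomials of greatest degree in every fibre
  (\<open>initial_ideal_eq\<close>). The tangent cone has dimension one, so it is Cohen-Macaulay once \<open>x\<^sub>1\<close> is
  not a zero divisor on it, and this means that the greatest degree in the fibre of \<open>s + n\<^sub>1\<close> is
  one more than that in the fibre of \<open>s\<close>. Equivalently, every monomial without \<open>x\<^sub>1\<close> whose
  fibre contains multiples of \<open>x\<^sub>1\<close> has among them one of at least its own degree; it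
  is then called dominated.

  In cases (ii) and (iii), replacing \<open>x\<^sub>3\<^bsup>a\<^esup>\<close> by \<open>x\<^sup>w\<close>, respectively \<open>x\<^sub>4\<^bsup>a\<^esup>\<close> by \<open>x\<^sup>z\<close>, reduces
  domination to the monomials treated by the hypothesis. Case (i) leaves the monomials with all
  exponents below the critical ones (\<open>x1_dominated_if_binomials_dominated\<close>). In a
  counterexample of least weight and, in its fibre, of greatest degree, no variable can be shared with
  a multiple of \<open>x\<^sub>1\<close> in the fibre, because it could be cancelled. This forces the counterexample to
  be a product of powers of exactly two variables that shares no variable with any other monomial of
  its fibre, hence an indispensable monomial, and forces the multiples of \<open>x\<^sub>1\<close> in the fibre to
  involve just \<open>x\<^sub>1\<close> and the fourth variable, with exponents below the critical ones. The difference
  is then a binomial in \<open>\<I>\<close>, and the degree hypothesis on \<open>\<I>\<close> gives the contradiction.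

  For Cohen-Macaulayness itself, two maps to a polynomial ring in one variable do the work. Setting
  \<open>x\<^sub>2 = x\<^sub>3 = x\<^sub>4 = 0\<close> has nilpotent kernel modulo \<open>I(C)\<^sub>*\<close>, so that the tangent cone has the prime
  spectrum of \<open>k[x\<^sub>1]\<close>. Sending a monomial to \<open>t\<^sup>s\<close>, if it has greatest degree in the fibre of its
  weight \<open>s\<close>, and to \<open>0\<close> otherwise embeds the tangent cone into \<open>k[t]\<close> as a module over
  \<open>k[x\<^sub>1] = k[t\<^bsup>n\<^sub>1\<^esup>]\<close>; this yields torsion-freeness and finite generation of ideals at once.
\<close>

section \<open>A criterion for Cohen-Macaulay rings of dimension one\<close>

lemma (in cring) genideal_empty: "Idl {} = {\<zero>}"
  using genideal_minimal[OF zeroideal, of "{}"] genideal_ideal[of "{}"]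
  by (auto dest: additive_subgroup.zero_closed[OF ideal.axioms(1)])

lemma primeideal_pow_mem:
  fixes R (structure)
  assumes "primeideal Q R" "a \<in> carrier R" "a [^] (k::nat) \<in> Q"
  shows "a \<in> Q"
proof -
  interpret primeideal Q R by fact
  show ?thesis using assms(3)
  proof (induction k)
    case 0
    then show ?case using one_imp_carrier I_notcarr by simp
  next
    case (Suc k)
    then show ?case using I_prime[of "a [^] k" a] assms(2) by auto
  qed
qed

text \<open>
  The ring has a single minimal prime \<open>N\<close>, which is its nilradical and its set of zero divisors. The
  condition \<open>zero_dim_mod\<close> says elementwise that \<open>R/(a)\<close> has dimension zero: some power of \<open>b\<close> is
  divisible by the next one modulo \<open>a\<close>. It bounds both the height and the depth by one.
\<close>
locale one_dim_unmixed = cring R + noetherian_ring R + primeideal N R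
  for R (structure) and N +
  assumes nilpotent: "a \<in> N \<Longrightarrow> \<exists>k::nat. a [^] k = \<zero>"
    and regular: "\<lbrakk>a \<in> carrier R - N; y \<in> carrier R; a \<otimes> y = \<zero>\<rbrakk> \<Longrightarrow> y = \<zero>"
    and zero_dim_mod: "\<lbrakk>a \<in> carrier R - N; b \<in> carrier R\<rbrakk> \<Longrightarrow>
      \<exists>k::nat. \<exists>r \<in> carrier R. \<exists>c \<in> carrier R. b [^] k \<otimes> (\<one> \<ominus> b \<otimes> r) = a \<otimes> c"
    and not_maximal: "maximalideal P R \<Longrightarrow> \<not> P \<subseteq> N"
begin

lemma one_not_mem: assumes "ideal Q R" "Q \<noteq> carrier R" shows "\<one> \<notin> Q"
  using ideal.one_imp_carrier assms by blast

lemma N_subset_prime: "primeideal Q R \<Longrightarrow> N \<subseteq> Q"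
proof
  fix a assume Q: "primeideal Q R" and a: "a \<in> N"
  obtain k :: nat where "a [^] k = \<zero>" using nilpotent a by blast
  moreover have "\<zero> \<in> Q"
    using Q by (simp add: additive_subgroup.zero_closed ideal.axioms(1) primeideal.axioms(1))
  ultimately show "a \<in> Q" using primeideal_pow_mem[OF Q, of a k] a Icarr by simp
qed

text \<open>
  An element of the middle prime outside the smallest one is not nilpotent, so modulo it every \<open>y\<close>
  satisfies \<open>y\<^sup>k (1 - y r) = 0\<close>. If \<open>y\<close> lies in the largest prime but not in the middle one, then
  \<open>1 - y r\<close> lies in the middle one, and \<open>1\<close> in the largest.
\<close>
lemma no_chain3:
  assumes Q: "primeideal Q0 R" "primeideal Q1 R" "primeideal Q2 R" and lt: "Q0 \<subset> Q1" "Q1 \<subset> Q2"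
  shows False
proof -
  interpret Q1: primeideal Q1 R by fact
  interpret Q2: primeideal Q2 R by fact
  obtain x where x: "x \<in> Q1" "x \<notin> Q0" using lt by blast
  obtain y where y: "y \<in> Q2" "y \<notin> Q1" using lt by blast
  have xc: "x \<in> carrier R" and yc: "y \<in> carrier R" using x y Q1.Icarr Q2.Icarr by auto
  have "x \<notin> N" using N_subset_prime[OF Q(1)] x by blast
  then obtain k :: nat and r c where r: "r \<in> carrier R" "c \<in> carrier R"
    and eq: "y [^] k \<otimes> (\<one> \<ominus> y \<otimes> r) = x \<otimes> c"
    using zero_dim_mod xc yc by blast
  have "y [^] k \<otimes> (\<one> \<ominus> y \<otimes> r) \<in> Q1"
    unfolding eq by (rule Q1.I_r_closed) (use x r in auto)
  moreover have "y [^] k \<notin> Q1" using primeideal_pow_mem[OF Q(2) yc] y by blast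
  ultimately have "\<one> \<ominus> y \<otimes> r \<in> Q1" using Q1.I_prime[of "y [^] k" "\<one> \<ominus> y \<otimes> r"] yc r by auto
  then have "\<one> \<ominus> y \<otimes> r \<in> Q2" using lt by blast
  moreover have "y \<otimes> r \<in> Q2" using Q2.I_r_closed y r by blast
  ultimately have "(\<one> \<ominus> y \<otimes> r) \<oplus> y \<otimes> r \<in> Q2" by (rule Q2.a_closed)
  moreover have "(\<one> \<ominus> y \<otimes> r) \<oplus> y \<otimes> r = \<one>" using yc r by algebra
  ultimately show False using one_not_mem[OF Q2.is_ideal] Q2.I_notcarr by auto
qed

lemma prime_height_maximal:
  assumes P: "maximalideal P R" shows "prime_height R P = 1"
proof (unfold prime_height_def, rule antisym)
  show "Sup {enat k |k Q. (\<forall>i\<le>k. primeideal (Q i) R) \<and> (\<forall>i<k. Q i \<subset> Q (Suc i)) \<and> Q k = P} \<le> 1"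
  proof (rule Sup_least, clarify)
    fix k and Q :: "nat \<Rightarrow> 'a set"
    assume Q: "\<forall>i\<le>k. primeideal (Q i) R" "\<forall>i<k. Q i \<subset> Q (Suc i)"
    have "\<not> 2 \<le> k"
    proof
      assume "2 \<le> k"
      then have "primeideal (Q 0) R" "primeideal (Q 1) R" "primeideal (Q 2) R" "Q 0 \<subset> Q 1" "Q 1 \<subset> Q 2"
        using Q(1)[rule_format, of 0] Q(1)[rule_format, of 1] Q(1)[rule_format, of 2]
          Q(2)[rule_format, of 0] Q(2)[rule_format, of 1] by (auto simp: numeral_2_eq_2)
      then show False by (rule no_chain3)
    qed
    then show "enat k \<le> 1" by (simp add: one_enat_def)
  qed
  have prime_P: "primeideal P R" by (rule maximalideal_prime[OF P])
  have "N \<subset> P" using N_subset_prime[OF prime_P] not_maximal[OF P] by blast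
  then have "(\<forall>i\<le>1::nat. primeideal (if i = 0 then N else P) R) \<and>
      (\<forall>i<1::nat. (if i = 0 then N else P) \<subset> (if Suc i = 0 then N else P)) \<and>
      (if (1::nat) = 0 then N else P) = P"
    using prime_P primeideal by auto
  then have "enat 1 \<in> {enat k |k Q. (\<forall>i\<le>k. primeideal (Q i) R) \<and> (\<forall>i<k. Q i \<subset> Q (Suc i)) \<and> Q k = P}"
    by (intro CollectI exI[of _ 1] exI[of _ "\<lambda>i::nat. if i = 0 then N else P"]) (simp add: one_enat_def)
  then show "1 \<le> Sup {enat k |k Q. (\<forall>i\<le>k. primeideal (Q i) R) \<and> (\<forall>i<k. Q i \<subset> Q (Suc i)) \<and> Q k = P}"
    by (intro Sup_upper) (simp add: one_enat_def)
qed

text \<open>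
  If \<open>a, b\<close> starts a regular sequence then \<open>b\<^sup>k (1 - b r) \<in> (a)\<close> can be divided by \<open>b\<^sup>k\<close>, which puts
  \<open>1\<close> into \<open>(a, b)\<close>.
\<close>
lemma regular_sequence_short:
  assumes reg: "regular_sequence R xs" shows "length xs \<le> 1"
proof (rule ccontr)
  assume "\<not> length xs \<le> 1"
  then have len: "1 < length xs" "xs \<noteq> []" by auto
  define a b where "a = xs ! 0" and "b = xs ! 1"
  have take1: "take 1 xs = [a]" using len by (cases xs) (auto simp: a_def)
  have ab: "a \<in> set xs" "b \<in> set xs" unfolding a_def b_def using len by (auto intro: nth_mem)
  have xsc: "set xs \<subseteq> carrier R" and proper: "Idl (set xs) \<noteq> carrier R"
    and nz: "\<And>i y. i < length xs \<Longrightarrow> y \<in> carrier R \<Longrightarrow> xs ! i \<otimes> y \<in> Idl (set (take i xs)) \<Longrightarrow>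
      y \<in> Idl (set (take i xs))"
    using reg by (auto simp: regular_sequence_def)
  have ac: "a \<in> carrier R" and bc: "b \<in> carrier R" using ab xsc by auto
  interpret I: ideal "Idl (set xs)" R using genideal_ideal[OF xsc] .
  interpret Ia: ideal "Idl {a}" R using genideal_ideal[of "{a}"] ac by simp
  have one: "\<one> \<notin> Idl (set xs)" using one_not_mem[OF I.is_ideal proper] .
  have a_nz: "y = \<zero>" if "y \<in> carrier R" "a \<otimes> y = \<zero>" for y
    using nz[of 0 y] that len by (simp add: a_def[symmetric] genideal_empty)
  have b_nz: "y \<in> Idl {a}" if "y \<in> carrier R" "b \<otimes> y \<in> Idl {a}" for y
    using nz[of 1 y, folded b_def, unfolded take1] that len by simp
  have "a \<notin> N"
  proof
    assume "a \<in> N"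
    then obtain k :: nat where k: "a [^] k = \<zero>" using nilpotent by blast
    have "y = \<zero>" if "y \<in> carrier R" "a [^] m \<otimes> y = \<zero>" for y and m :: nat
      using that
    proof (induction m arbitrary: y)
      case (Suc m)
      have "a [^] m \<otimes> (a \<otimes> y) = \<zero>" using Suc.prems ac by (simp add: m_assoc)
      then have "a \<otimes> y = \<zero>" using Suc ac by blast
      then show ?case using a_nz Suc.prems by blast
    qed simp
    from this[of \<one> k] k have "\<one> = \<zero>" by simp
    then show False using one I.zero_closed by simp
  qed
  then obtain k :: nat and r c where r: "r \<in> carrier R" "c \<in> carrier R"
    and eq: "b [^] k \<otimes> (\<one> \<ominus> b \<otimes> r) = a \<otimes> c"
    using zero_dim_mod ac bc by blast
  have strip: "y \<in> Idl {a}" if "y \<in> carrier R" "b [^] m \<otimes> y \<in> Idl {a}" for y and m :: nat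
    using that
  proof (induction m arbitrary: y)
    case (Suc m)
    have "b [^] m \<otimes> (b \<otimes> y) \<in> Idl {a}" using Suc.prems bc by (simp add: m_assoc)
    then have "b \<otimes> y \<in> Idl {a}" using Suc bc by blast
    then show ?case using b_nz Suc.prems by blast
  qed simp
  have "a \<in> Idl {a}" using genideal_self[of "{a}"] ac by simp
  then have "b [^] k \<otimes> (\<one> \<ominus> b \<otimes> r) \<in> Idl {a}" unfolding eq using Ia.I_r_closed r by blast
  then have "\<one> \<ominus> b \<otimes> r \<in> Idl {a}" by (rule strip[rotated]) (simp add: bc r)
  moreover have "Idl {a} \<subseteq> Idl (set xs)" using subset_Idl_subset[OF xsc, of "{a}"] ab by simp
  ultimately have "\<one> \<ominus> b \<otimes> r \<in> Idl (set xs)" by blast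
  moreover have "b \<otimes> r \<in> Idl (set xs)" using genideal_self[OF xsc] ab r by (intro I.I_r_closed) auto
  ultimately have "(\<one> \<ominus> b \<otimes> r) \<oplus> b \<otimes> r \<in> Idl (set xs)" by (rule I.a_closed)
  moreover have "(\<one> \<ominus> b \<otimes> r) \<oplus> b \<otimes> r = \<one>" using bc r by algebra
  ultimately show False using one by simp
qed

lemma ideal_depth_maximal:
  assumes P: "maximalideal P R" shows "ideal_depth R P = 1"
proof (unfold ideal_depth_def, rule antisym)
  show "Sup {enat (length xs) |xs. regular_sequence R xs \<and> set xs \<subseteq> P} \<le> 1"
    using regular_sequence_short by (intro Sup_least) (auto simp: one_enat_def)
  interpret P: maximalideal P R by fact
  obtain a where a: "a \<in> P" "a \<notin> N" using not_maximal[OF P] by blast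
  have ac: "a \<in> carrier R" using a P.Icarr by blast
  have "Idl {a} \<subseteq> P" using genideal_minimal[OF P.is_ideal] a by simp
  then have "Idl {a} \<noteq> carrier R" using P.I_notcarr P.a_subset by blast
  then have "regular_sequence R [a]"
  proof (unfold regular_sequence_def, intro conjI allI impI ballI)
    fix i y assume i: "i < length [a]" and y: "y \<in> carrier R"
      and ay: "[a] ! i \<otimes> y \<in> Idl (set (take i [a]))"
    have "i = 0" using i by simp
    then have "a \<otimes> y = \<zero>" using ay by (simp add: genideal_empty)
    then have "y = \<zero>" using regular[of a y] y ac a by blast
    then show "y \<in> Idl (set (take i [a]))" using \<open>i = 0\<close> by (simp add: genideal_empty)
  qed (use ac in simp_all)
  then have "enat 1 \<in> {enat (length xs) |xs. regular_sequence R xs \<and> set xs \<subseteq> P}"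
    using a by (intro CollectI exI[of _ "[a]"]) simp
  then show "1 \<le> Sup {enat (length xs) |xs. regular_sequence R xs \<and> set xs \<subseteq> P}"
    by (intro Sup_upper) (simp add: one_enat_def)
qed

lemma cohen_macaulay: "cohen_macaulay_ring R"
  unfolding cohen_macaulay_ring_def
  using ideal_depth_maximal prime_height_maximal is_cring noetherian_ring_axioms by simp

end

section \<open>The criterion for quotients by an ideal\<close>

lemma type_ring_simps [simp]:
  fixes x y :: "'a::comm_ring_1"
  defines "T \<equiv> (ring_of_type_algebra :: 'a ring)"
  shows "carrier T = UNIV" "x \<otimes>\<^bsub>T\<^esub> y = x * y" "x \<oplus>\<^bsub>T\<^esub> y = x + y" "\<one>\<^bsub>T\<^esub> = 1" "\<zero>\<^bsub>T\<^esub> = 0"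
  by (simp_all add: T_def ring_of_type_algebra_def)

lemma type_ring_a_inv [simp]: "\<ominus>\<^bsub>ring_of_type_algebra\<^esub> x = - (x :: 'a::comm_ring_1)"
proof -
  interpret cring "ring_of_type_algebra :: 'a ring" by (rule cring_from_type_algebra)
  show ?thesis by (rule minus_equality) simp_all
qed

lemma type_ring_a_minus [simp]: "x \<ominus>\<^bsub>ring_of_type_algebra\<^esub> y = x - (y :: 'a::comm_ring_1)"
  by (simp add: a_minus_def)

lemma ideal_type_ring_iff:
  "ideal L (ring_of_type_algebra :: 'a::comm_ring_1 ring) \<longleftrightarrow>
    0 \<in> L \<and> (\<forall>x\<in>L. \<forall>y\<in>L. x + y \<in> L) \<and> (\<forall>x\<in>L. \<forall>c. c * x \<in> L)" (is "?l \<longleftrightarrow> ?r")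
proof
  interpret cring "ring_of_type_algebra :: 'a ring" by (rule cring_from_type_algebra)
  { assume ?l
    then interpret ideal L "ring_of_type_algebra :: 'a ring" .
    show ?r using zero_closed a_closed I_l_closed by simp }
  assume r: ?r
  have neg: "- x \<in> L" if "x \<in> L" for x using r that by (metis mult_minus1)
  show ?l
  proof (rule idealI)
    show "ring (ring_of_type_algebra :: 'a ring)" by (rule ring_axioms)
    show "subgroup L (add_monoid (ring_of_type_algebra :: 'a ring))"
      using r neg by (intro add.subgroupI) (auto simp flip: a_inv_def)
  qed (use r in \<open>auto simp: mult.commute\<close>)
qed

lemma ideal_diff:
  "ideal L (ring_of_type_algebra :: 'a::comm_ring_1 ring) \<Longrightarrow> x \<in> L \<Longrightarrow> y \<in> L \<Longrightarrow> x - y \<in> L"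
  by (metis add_uminus_conv_diff ideal_type_ring_iff mult_minus1)

text \<open>
  The criterion in terms of preimages in the ring above, where elements need no carrier. The ideal
  \<open>M\<close> strictly between \<open>N\<close> and the unit ideal keeps \<open>N\<close> from being maximal.
\<close>
lemma cohen_macaulay_quotient:
  fixes J N M :: "'a::comm_ring_1 set"
  defines "T \<equiv> (ring_of_type_algebra :: 'a ring)"
  assumes J: "ideal J T" and N: "primeideal N T" and JN: "J \<subseteq> N"
    and M: "ideal M T" "N \<subset> M" "1 \<notin> M"
    and nilp: "\<And>f. f \<in> N \<Longrightarrow> \<exists>k. f ^ k \<in> J"
    and nzd: "\<And>f g. f \<notin> N \<Longrightarrow> f * g \<in> J \<Longrightarrow> g \<in> J"
    and dim: "\<And>f g. f \<notin> N \<Longrightarrow> \<exists>k r c. g ^ k * (1 - g * r) - f * c \<in> J"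
    and noeth: "\<And>L. ideal L T \<Longrightarrow> J \<subseteq> L \<Longrightarrow>
       \<exists>A. finite A \<and> A \<subseteq> L \<and> (\<forall>L'. ideal L' T \<longrightarrow> J \<subseteq> L' \<longrightarrow> A \<subseteq> L' \<longrightarrow> L \<subseteq> L')"
  shows "cohen_macaulay_ring (T Quot J)"
proof -
  interpret T: cring T unfolding T_def by (rule cring_from_type_algebra)
  note T_simps = type_ring_simps[where 'a='a, folded T_def]
    type_ring_a_minus[where 'a='a, folded T_def]
  note ideal_iff = ideal_type_ring_iff[where 'a='a, folded T_def]
  interpret J: ideal J T by fact
  define R where "R = T Quot J"
  interpret R: cring R unfolding R_def by (rule J.quotient_is_cring) (rule T.is_cring)
  define h where "h f = J +>\<^bsub>T\<^esub> f" for f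
  interpret h: ring_hom_ring T R h
    using J.rcos_ring_hom_ring by (simp add: R_def h_def[abs_def])
  have h_hom: "h (f + g) = h f \<oplus>\<^bsub>R\<^esub> h g" "h (f * g) = h f \<otimes>\<^bsub>R\<^esub> h g"
    "h 1 = \<one>\<^bsub>R\<^esub>" "h 0 = \<zero>\<^bsub>R\<^esub>" "h f \<in> carrier R" for f g
    using h.hom_add[of f g] h.hom_mult[of f g] h.hom_one h.hom_zero h.hom_closed[of f]
    by (simp_all add: T_simps)
  have h_pow: "h (f ^ k) = h f [^]\<^bsub>R\<^esub> k" for f and k :: nat
    by (induction k) (simp_all add: h_hom R.m_comm)
  have carr: "carrier R = range h"
    by (auto simp: R_def FactRing_def A_RCOSETS_def' h_def a_r_coset_def T_simps)
  have h_eq: "h f = h g \<longleftrightarrow> f - g \<in> J" for f g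
    using T.quotient_eq_iff_same_a_r_cos[OF J, of f g] by (simp add: h_def T_simps)
  have h_diff: "h (f - g) = h f \<ominus>\<^bsub>R\<^esub> h g" for f g
    using h.hom_a_inv[of g] h_hom(1)[of f "- g"] 
    by (simp add: T_simps type_ring_a_inv[where 'a='a, folded T_def] a_minus_def)
  have h_zero: "h f = \<zero>\<^bsub>R\<^esub> \<longleftrightarrow> f \<in> J" for f
    using h_eq[of f 0] by (simp add: h_hom)
  have h_image: "h f \<in> h ` L \<longleftrightarrow> f \<in> L" if "ideal L T" "J \<subseteq> L" for f L
  proof
    assume "h f \<in> h ` L"
    then obtain g where g: "g \<in> L" "f - g \<in> J" by (auto simp: h_eq)
    then have "(f - g) + g \<in> L" using that ideal_iff by blast
    then show "f \<in> L" by simp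
  qed simp
  have h_ideal: "ideal (h ` L) R" if "ideal L T" for L
    using T.ring_ideal_imp_quot_ideal[OF J that] by (simp add: R_def h_def[abs_def])
  have vimage: "ideal {f. h f \<in> L} T" if "ideal L R" for L
    using h.ideal_vimage[OF that] by (simp add: T_simps)
  have J_vimage: "J \<subseteq> {f. h f \<in> L}" if "ideal L R" for L
    using additive_subgroup.zero_closed[OF ideal.axioms(1)[OF that]]
    by (metis h_zero mem_Collect_eq subsetI)
  interpret N: primeideal N T by fact
  have JM: "J \<subseteq> M" using JN M by blast
  have prime_hN: "primeideal (h ` N) R"
  proof (rule primeidealI)
    show "ideal (h ` N) R" using h_ideal N.is_ideal .
    show "cring R" by (rule R.is_cring)
    have "1 \<notin> N" using N.one_imp_carrier N.I_notcarr by (auto simp: T_simps)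
    then show "carrier R \<noteq> h ` N" using h_image[OF N.is_ideal JN, of 1] h_hom(5)[of 1] by metis
    fix a b assume "a \<in> carrier R" "b \<in> carrier R" and ab: "a \<otimes>\<^bsub>R\<^esub> b \<in> h ` N"
    then obtain f g where fg: "a = h f" "b = h g" using carr by auto
    then have "f * g \<in> N" using ab h_image[OF N.is_ideal JN] h_hom by metis
    then show "a \<in> h ` N \<or> b \<in> h ` N" using N.I_prime[of f g] fg by (auto simp: T_simps)
  qed
  have "one_dim_unmixed R (h ` N)"
  proof (intro one_dim_unmixed.intro one_dim_unmixed_axioms.intro)
    show "cring R" by (rule R.is_cring)
    show "primeideal (h ` N) R" by (rule prime_hN)
    show "noetherian_ring R"
    proof (intro noetherian_ring.intro noetherian_ring_axioms.intro)
      show "ring R" by (rule R.ring_axioms)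
      fix I assume I: "ideal I R"
      interpret I: ideal I R by fact
      obtain A where A: "finite A" "A \<subseteq> {f. h f \<in> I}"
        "\<And>L'. ideal L' T \<Longrightarrow> J \<subseteq> L' \<Longrightarrow> A \<subseteq> L' \<Longrightarrow> {f. h f \<in> I} \<subseteq> L'"
        using noeth[OF vimage[OF I] J_vimage[OF I]] by auto
      have hA: "h ` A \<subseteq> carrier R" using carr by auto
      interpret IA: ideal "genideal R (h ` A)" R by (rule R.genideal_ideal[OF hA])
      have "{f. h f \<in> I} \<subseteq> {f. h f \<in> genideal R (h ` A)}"
      proof (rule A(3))
        show "ideal {f. h f \<in> genideal R (h ` A)} T" by (rule vimage) (rule IA.is_ideal)
        show "J \<subseteq> {f. h f \<in> genideal R (h ` A)}" by (rule J_vimage) (rule IA.is_ideal)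
        show "A \<subseteq> {f. h f \<in> genideal R (h ` A)}" using R.genideal_self[OF hA] by auto
      qed
      then have "I \<subseteq> genideal R (h ` A)" using I.a_subset unfolding carr by auto
      moreover have "genideal R (h ` A) \<subseteq> I" by (rule R.genideal_minimal[OF I]) (use A in auto)
      ultimately show "\<exists>A\<subseteq>carrier R. finite A \<and> I = genideal R A" using hA A(1) by blast
    qed
    show "\<exists>k::nat. a [^]\<^bsub>R\<^esub> k = \<zero>\<^bsub>R\<^esub>" if "a \<in> h ` N" for a
      using that nilp h_pow h_zero by (metis imageE)
    show "y = \<zero>\<^bsub>R\<^esub>" if ay: "a \<in> carrier R - h ` N" "y \<in> carrier R" "a \<otimes>\<^bsub>R\<^esub> y = \<zero>\<^bsub>R\<^esub>" for a y
    proof -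
      obtain f g where "a = h f" "y = h g" using ay carr by auto
      then show ?thesis using ay nzd[of f g] h_zero h_hom(2) by (metis DiffD2 imageI)
    qed
    show "\<exists>k::nat. \<exists>r\<in>carrier R. \<exists>c\<in>carrier R. b [^]\<^bsub>R\<^esub> k \<otimes>\<^bsub>R\<^esub> (\<one>\<^bsub>R\<^esub> \<ominus>\<^bsub>R\<^esub> b \<otimes>\<^bsub>R\<^esub> r) = a \<otimes>\<^bsub>R\<^esub> c"
      if ab: "a \<in> carrier R - h ` N" "b \<in> carrier R" for a b
    proof -
      obtain f g where fg: "a = h f" "b = h g" using ab carr by auto
      then have "f \<notin> N" using ab by auto
      from dim[OF this, of g] obtain k r c where "g ^ k * (1 - g * r) - f * c \<in> J" by blast
      then have "h (g ^ k * (1 - g * r)) = h (f * c)" by (simp add: h_eq)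
      then have "b [^]\<^bsub>R\<^esub> k \<otimes>\<^bsub>R\<^esub> (\<one>\<^bsub>R\<^esub> \<ominus>\<^bsub>R\<^esub> b \<otimes>\<^bsub>R\<^esub> h r) = a \<otimes>\<^bsub>R\<^esub> h c"
        by (simp only: fg h_hom h_pow h_diff)
      then show ?thesis using h_hom(5) by blast
    qed
    show "\<not> P \<subseteq> h ` N" if P: "maximalideal P R" for P
    proof
      interpret P: maximalideal P R by fact
      assume sub: "P \<subseteq> h ` N"
      then have "P \<subseteq> h ` M" using M by blast
      moreover have "h ` M \<subseteq> carrier R" using carr by auto
      ultimately have "h ` M = P \<or> h ` M = carrier R"
        using P.I_maximal[OF h_ideal[OF M(1)]] by blast
      moreover have "h ` M \<noteq> carrier R" using h_image[OF M(1) JM, of 1] M(3) h_hom(5)[of 1] by metis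
      ultimately have "h ` M \<subseteq> h ` N" using sub by blast
      then have "M \<subseteq> N" using h_image[OF N.is_ideal JN] by blast
      then show False using M by blast
    qed
  qed
  then show ?thesis using one_dim_unmixed.cohen_macaulay R_def by blast
qed

section \<open>Exponent vectors and fibres of the weight\<close>

abbreviation expo :: "mon \<Rightarrow> var \<Rightarrow> nat" where
  "expo u i \<equiv> Poly_Mapping.lookup u i"

definition wt :: "(var \<Rightarrow> nat) \<Rightarrow> mon \<Rightarrow> nat" where
  "wt n u = (\<Sum>i\<in>UNIV. expo u i * n i)"

lemma sum_var: "(\<Sum>i\<in>UNIV. f i) = f X1 + f X2 + f X3 + (f X4 :: 'a::comm_monoid_add)"
  by (simp add: UNIV_var add.assoc)

lemma wt_add [simp]: "wt n (u + v) = wt n u + wt n v"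
  by (simp add: wt_def lookup_add algebra_simps sum.distrib)

lemma mdeg_add [simp]: "mdeg (u + v) = mdeg u + mdeg v"
  by (simp add: mdeg_def lookup_add sum.distrib)

lemma wt_xpow [simp]: "wt n (xpow i k) = k * n i"
  by (cases i) (simp_all add: wt_def sum_var lookup_single)

lemma mdeg_xpow [simp]: "mdeg (xpow i k) = k"
  by (cases i) (simp_all add: mdeg_def sum_var lookup_single)

lemma wt_zero [simp]: "wt n 0 = 0" and mdeg_zero [simp]: "mdeg 0 = 0"
  by (simp_all add: wt_def mdeg_def)

lemma in_supp: "i \<in> supp u \<longleftrightarrow> 0 < expo u i"
  by (simp add: in_keys_iff)

lemma xpow_divides:
  assumes "k \<le> expo u i" obtains u' where "u = xpow i k + u'"
proof
  show "u = xpow i k + (u - xpow i k)"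
    using assms by (intro poly_mapping_eqI) (auto simp: lookup_add lookup_minus lookup_single when_def)
qed

lemma mon_eq_xpow: assumes "\<And>j. j \<noteq> i \<Longrightarrow> expo u j = 0" shows "u = xpow i (expo u i)"
  using assms by (intro poly_mapping_eqI) (auto simp: lookup_single when_def)

lemma mon_eq_xpow2: assumes "i \<noteq> j" "\<And>k. k \<noteq> i \<Longrightarrow> k \<noteq> j \<Longrightarrow> expo u k = 0"
  shows "u = xpow i (expo u i) + xpow j (expo u j)"
  using assms by (intro poly_mapping_eqI) (auto simp: lookup_single when_def lookup_add)

text \<open>The monomial \<open>t\<close> is the greatest common divisor.\<close>
lemma cancel_common_divisor:
  fixes M M' :: mon
  obtains t m m' where "M = t + m" "M' = t + m'" "\<And>i. expo m i = 0 \<or> expo m' i = 0"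
    "\<And>i. expo t i = min (expo M i) (expo M' i)"
proof
  show "M = (M - (M - M')) + (M - M')" "M' = (M - (M - M')) + (M' - M)"
    by (intro poly_mapping_eqI; simp add: lookup_add lookup_minus)+
qed (auto simp: lookup_minus)

lemma wt_ge: assumes "\<And>i. 0 < expo u i \<Longrightarrow> c \<le> n i" shows "c * mdeg u \<le> wt n u"
  unfolding wt_def mdeg_def sum_distrib_left
  by (rule sum_mono) (metis assms le_zero_eq mult.commute mult_le_mono2 not_gr_zero mult_0)

lemma wt_le: assumes "\<And>i. 0 < expo u i \<Longrightarrow> n i \<le> c" shows "wt n u \<le> c * mdeg u"
  unfolding wt_def mdeg_def sum_distrib_left
  by (rule sum_mono) (metis assms le_zero_eq mult.commute mult_le_mono2 not_gr_zero mult_0)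

text \<open>
  Two monomials of a fibre that share a variable differ by a multiple of a binomial of smaller
  weight. So an isolated monomial cannot be reached from the rest of its fibre by moves that
  preserve a common factor, which is the reason why it is indispensable.
\<close>
definition isolated :: "(var \<Rightarrow> nat) \<Rightarrow> mon \<Rightarrow> bool" where
  "isolated n M \<longleftrightarrow> (\<forall>M'. wt n M' = wt n M \<and> M' \<noteq> M \<longrightarrow> (\<forall>i. expo M i = 0 \<or> expo M' i = 0))"

text \<open>
  Inside its fibre, and without loss of degree, a dominated monomial can be traded for a multiple of
  \<open>x\<^sub>1\<close>. Multiples of \<open>x\<^sub>1\<close> are trivially dominated.
\<close>
definition x1_dominated :: "(var \<Rightarrow> nat) \<Rightarrow> mon \<Rightarrow> bool" where
  "x1_dominated n M \<longleftrightarrow> (\<exists>N. 0 < expo N X1 \<and> wt n N = wt n M \<and> mdeg M \<le> mdeg N)"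

locale positive_weights =
  fixes n :: "var \<Rightarrow> nat"
  assumes n_pos: "0 < n X1" and incr: "n X1 < n X2" "n X2 < n X3" "n X3 < n X4"
begin

lemma n_gt0: "0 < n i"
  using n_pos incr by (cases i) auto

lemma n_gt1: "i \<noteq> X1 \<Longrightarrow> n X1 < n i"
  using incr by (cases i) auto

lemma mdeg_le_wt: "mdeg u \<le> wt n u"
  using wt_ge[of u 1 n] n_gt0 by (simp add: Suc_leI)

end

section \<open>Domination of monomials with small exponents\<close>

text \<open>
  \<open>a i\<close> is the critical exponent of \<open>x\<^sub>i\<close>, and \<open>r i\<close> is the second monomial of a critical
  binomial.
\<close>
locale critical_monomials = positive_weights +
  fixes a :: "var \<Rightarrow> nat" and r :: "var \<Rightarrow> mon"
  assumes a_pos: "0 < a i"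
    and r_supp: "expo (r i) i = 0"
    and r_wt: "wt n (r i) = a i * n i"
    and a_min: "0 < b \<Longrightarrow> expo q i = 0 \<Longrightarrow> wt n q = b * n i \<Longrightarrow> a i \<le> b"
begin

lemma n_ge1: "n X1 \<le> n i"
  using incr by (cases i) auto

lemma wt_eq_0: assumes "wt n u = 0" shows "u = 0"
proof (rule poly_mapping_eqI)
  fix i
  have "expo u i * n i = 0" using assms by (simp add: wt_def)
  then show "expo u i = expo 0 i" using n_gt0[of i] by simp
qed

lemma x1_dominated_of_divisor:
  assumes "M = xpow j k + M0" "x1_dominated n M0" shows "x1_dominated n M"
proof -
  from assms(2) obtain N where "0 < expo N X1" "wt n N = wt n M0" "mdeg M0 \<le> mdeg N"
    by (auto simp: x1_dominated_def)
  then show ?thesis using assms(1)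
    by (auto simp: x1_dominated_def lookup_add intro!: exI[of _ "xpow j k + N"])
qed

lemma x1_dominated_of_replacement:
  assumes "a i \<le> expo M i" "0 < expo (r i) X1" "a i \<le> mdeg (r i)"
  shows "x1_dominated n M"
proof -
  obtain M0 where "M = xpow i (a i) + M0" using xpow_divides[OF assms(1)] .
  then show ?thesis using assms
    by (auto simp: x1_dominated_def lookup_add r_wt intro!: exI[of _ "r i + M0"])
qed

text \<open>The weight of \<open>x\<^sub>4\<close> is the largest one.\<close>
lemma mdeg_r4: "a X4 \<le> mdeg (r X4)"
proof -
  have "n i \<le> n X4" for i using incr by (cases i) auto
  then have "wt n (r X4) \<le> n X4 * mdeg (r X4)" by (intro wt_le)
  then show ?thesis using n_gt0[of X4] by (simp add: r_wt mult.commute)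
qed

text \<open>The weight of \<open>x\<^sub>1\<close> is the smallest one, so a power of \<open>x\<^sub>1\<close> has the greatest degree in its fibre.\<close>
lemma x1_dominated_of_pure:
  assumes "wt n P = wt n M" "0 < expo P X1" "\<And>i. i \<noteq> X1 \<Longrightarrow> expo P i = 0"
  shows "x1_dominated n M"
proof -
  have "P = xpow X1 (expo P X1)" using assms(3) by (rule mon_eq_xpow)
  then have "wt n P = n X1 * mdeg P" by (metis wt_xpow mdeg_xpow mult.commute)
  moreover have "n X1 * mdeg M \<le> wt n M" by (rule wt_ge) (rule n_ge1)
  ultimately show ?thesis using assms n_pos by (auto simp: x1_dominated_def)
qed

text \<open>
  The combinatorial core. Domination is assumed only for monomials in which just the exponent of
  \<open>x\<^sub>2\<close> reaches the critical one (\<open>large\<close>) and for isolated monomials in two variables whose fibre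
  contains a monomial in the other two with exponents below the critical ones (\<open>binom\<close>). Take a
  counterexample \<open>B\<close> of least weight \<open>s\<close>, and of greatest degree in its fibre. By \<open>disj1\<close>, a variable common to \<open>B\<close> and a multiple of \<open>x\<^sub>1\<close> in the fibre could be cancelled. By
  \<open>deg_max\<close>, nothing in the fibre has greater degree than \<open>B\<close>. These two facts show that \<open>B\<close> is one
  of the isolated monomials of the assumption.
\<close>
lemma x1_dominated_if_binomials_dominated:
  assumes case1: "\<And>i j. i \<noteq> j \<Longrightarrow> a i * n i \<noteq> a j * n j"
    and r3: "0 < expo (r X3) X1" "a X3 \<le> mdeg (r X3)"
    and r4: "0 < expo (r X4) X1"
    and binom: "\<And>l i j p q d e. {X1, l, i, j} = UNIV \<Longrightarrow> i \<noteq> X1 \<Longrightarrow> j \<noteq> X1 \<Longrightarrow> 0 < p \<Longrightarrow> p < a X1 \<Longrightarrow> 0 < q \<Longrightarrow> q < a l \<Longrightarrow>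
       0 < d \<Longrightarrow> 0 < e \<Longrightarrow> wt n (xpow X1 p + xpow l q) = wt n (xpow i d + xpow j e) \<Longrightarrow>
       isolated n (xpow i d + xpow j e) \<Longrightarrow>
       mdeg (xpow i d + xpow j e) \<le> mdeg (xpow X1 p + xpow l q)"
    and large: "\<And>M P. expo M X1 = 0 \<Longrightarrow> a X2 \<le> expo M X2 \<Longrightarrow> expo M X3 < a X3 \<Longrightarrow> expo M X4 < a X4 \<Longrightarrow>
       0 < expo P X1 \<Longrightarrow> wt n P = wt n M \<Longrightarrow> x1_dominated n M"
    and M: "expo M X1 = 0" and P: "0 < expo P X1" "wt n P = wt n M"
  shows "x1_dominated n M"
  using M P
proof (induction "wt n M" arbitrary: M P rule: less_induct)
  case less
  show ?case
  proof (rule ccontr)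
    assume not_dominated: "\<not> x1_dominated n M"
    define s where "s = wt n M"
    define bad where "bad M' \<longleftrightarrow> expo M' X1 = 0 \<and> wt n M' = s \<and> \<not> x1_dominated n M'" for M'
    have "bad M" using less.prems not_dominated by (simp add: bad_def s_def)
    moreover have "\<forall>y. bad y \<longrightarrow> mdeg y < Suc s" by (metis bad_def mdeg_le_wt le_imp_less_Suc)
    ultimately have "\<exists>B. bad B \<and> (\<forall>y. bad y \<longrightarrow> mdeg y \<le> mdeg B)"
      by (rule Lattices_Big.ex_has_greatest_nat)
    then obtain B where B: "bad B" and B_max: "\<And>y. bad y \<Longrightarrow> mdeg y \<le> mdeg B" by blast
    have B_props: "expo B X1 = 0" "wt n B = s" "\<not> x1_dominated n B" using B by (auto simp: bad_def)
    have wtP: "wt n P = s" using less.prems s_def by simp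
    have disj1: "expo B k = 0 \<or> expo Q k = 0" if "0 < expo Q X1" "wt n Q = s" for Q k
    proof (rule ccontr)
      assume *: "\<not> (expo B k = 0 \<or> expo Q k = 0)"
      then have k: "k \<noteq> X1" using B_props by auto
      from * obtain B0 where B0: "B = xpow k 1 + B0" using xpow_divides[of 1 B k] by auto
      from * obtain Q0 where Q0: "Q = xpow k 1 + Q0" using xpow_divides[of 1 Q k] by auto
      have "x1_dominated n B0"
      proof (rule less.hyps)
        show "wt n B0 < wt n M" using B0 B_props n_gt0[of k] s_def by auto
        show "expo B0 X1 = 0" using B0 B_props by (auto simp: lookup_add)
        show "0 < expo Q0 X1" using Q0 that k by (auto simp: lookup_add lookup_single)
        show "wt n Q0 = wt n B0" using Q0 B0 that B_props by auto
      qed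
      then show False using x1_dominated_of_divisor[OF B0] B_props by simp
    qed
    have deg_max: "mdeg Q \<le> mdeg B" if "wt n Q = s" for Q
    proof (rule ccontr)
      assume *: "\<not> mdeg Q \<le> mdeg B"
      show False
      proof (cases "bad Q")
        case True then show False using B_max * by blast
      next
        case False
        then have "x1_dominated n Q"
          using that by (auto simp: bad_def x1_dominated_def)
        then show False using * that B_props unfolding x1_dominated_def
          by (metis le_trans nle_le)
      qed
    qed
    have small: "expo B i < a i" for i
    proof (cases i)
      case X1 then show ?thesis using B_props a_pos by simp
    next
      case X3 then show ?thesis using x1_dominated_of_replacement[of X3 B] r3 B_props by force
    next
      case X4 then show ?thesis using x1_dominated_of_replacement[of X4 B] r4 mdeg_r4 B_props by force
    next
      case X2
      have "expo B X3 < a X3" using x1_dominated_of_replacement[of X3 B] r3 B_props by force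
      moreover have "expo B X4 < a X4" using x1_dominated_of_replacement[of X4 B] r4 mdeg_r4 B_props by force
      ultimately show ?thesis using large[of B P] less.prems wtP B_props X2 by force
    qed
    \<comment> \<open>A power of \<open>x\<^sub>i\<close> with a multiple of \<open>x\<^sub>1\<close> prime to it in the fibre has exponent at least \<open>a i\<close>.\<close>
    have not_pure: "False" if "\<And>j. j \<noteq> i \<Longrightarrow> expo B j = 0" for i
    proof -
      have B_eq: "B = xpow i (expo B i)" using mon_eq_xpow that by blast
      have "0 < wt n P" using less.prems(2) wt_eq_0[of P] by (metis lookup_zero not_gr_zero)
      then have "0 < expo B i" using B_eq wtP B_props
        by (metis gr0I single_zero wt_zero)
      moreover have "expo P i = 0" using disj1[OF less.prems(2) wtP, of i] calculation by simp
      moreover have "wt n P = expo B i * n i" using wtP B_props B_eq by (metis wt_xpow)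
      ultimately have "a i \<le> expo B i" by (intro a_min)
      then show False using small[of i] by simp
    qed
    \<comment> \<open>If \<open>x\<^sub>2, x\<^sub>3, x\<^sub>4\<close> all divided \<open>B\<close>, then \<open>P\<close> would be a power of \<open>x\<^sub>1\<close>.\<close>
    have not_all: "\<exists>l. l \<noteq> X1 \<and> expo B l = 0"
    proof (rule ccontr)
      assume "\<not> ?thesis"
      then have "expo P l = 0" if "l \<noteq> X1" for l using disj1[OF less.prems(2) wtP, of l] that by auto
      then show False using x1_dominated_of_pure[of P B] less.prems wtP B_props by auto
    qed
    then obtain l where l: "l \<noteq> X1" "expo B l = 0" by blast
    obtain i j where ij: "{X1, l, i, j} = UNIV" "i \<noteq> j" "i \<noteq> l" "j \<noteq> l" "i \<noteq> X1" "j \<noteq> X1"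
    proof (cases l)
      case X1 with l show ?thesis by simp
    next
      case X2 show ?thesis by (rule that[of X3 X4]) (auto simp: X2 UNIV_var)
    next
      case X3 show ?thesis by (rule that[of X2 X4]) (auto simp: X3 UNIV_var)
    next
      case X4 show ?thesis by (rule that[of X2 X3]) (auto simp: X4 UNIV_var)
    qed
    have each: "k = X1 \<or> k = l \<or> k = i \<or> k = j" for k using ij(1) by auto
    have Bi: "0 < expo B i" using not_pure[of j] each B_props l by (metis gr0I)
    have Bj: "0 < expo B j" using not_pure[of i] each B_props l by (metis gr0I)
    have B_eq: "B = xpow i (expo B i) + xpow j (expo B j)"
      by (rule mon_eq_xpow2[OF ij(2)]) (metis each B_props(1) l(2))
    \<comment> \<open>If \<open>M'\<close> shares a variable with \<open>B\<close>, cancelling the common divisor \<open>t\<close> leaves \<open>m\<close> in the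
      variables \<open>x\<^sub>i, x\<^sub>j\<close> against a power of \<open>x\<^sub>l\<close> with exponent at least \<open>a l\<close>. For \<open>l = 2\<close> the power has
      greater degree than \<open>m\<close>, against \<open>deg_max\<close>. For \<open>l = 3, 4\<close> the critical replacement brings in
      \<open>x\<^sub>1\<close> while the variables of \<open>t\<close> remain, against \<open>disj1\<close>.\<close>
    have iso: "isolated n B"
      unfolding isolated_def
    proof (intro allI impI, rule ccontr)
      fix M' k assume M': "wt n M' = wt n B \<and> M' \<noteq> B" and k: "\<not> (expo B k = 0 \<or> expo M' k = 0)"
      obtain t m m' where tm: "B = t + m" "M' = t + m'" "\<And>i. expo m i = 0 \<or> expo m' i = 0"
        "\<And>i. expo t i = min (expo B i) (expo M' i)"
        using cancel_common_divisor[of B M'] by metis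
      have tk: "0 < expo t k" using tm(4)[of k] k by auto
      have M'1: "expo M' X1 = 0" using disj1[of M' k] M' k B_props by auto
      have wtm: "wt n m = wt n m'" using M' tm by simp
      have ne: "m \<noteq> m'" using M' tm by auto
      have "wt n m \<noteq> 0" using wtm ne wt_eq_0 by metis
      have m_le: "expo m i' \<le> expo B i'" for i' using tm(1) by (simp add: lookup_add)
      have not_pure_m: False if "\<And>k. k \<noteq> i' \<Longrightarrow> expo m k = 0" for i'
      proof -
        have m_eq: "m = xpow i' (expo m i')" using mon_eq_xpow that by blast
        have "0 < expo m i'" using m_eq \<open>wt n m \<noteq> 0\<close> by (metis gr0I single_zero wt_zero)
        moreover have "expo m' i' = 0" using tm(3)[of i'] calculation by simp
        moreover have "wt n m' = expo m i' * n i'" using wtm m_eq by (metis wt_xpow)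
        ultimately have "a i' \<le> expo m i'" by (intro a_min)
        then show False using small[of i'] m_le[of i'] by simp
      qed
      have m0: "expo m X1 = 0" "expo m l = 0" using m_le[of X1] m_le[of l] B_props l by auto
      have mi: "0 < expo m i" using not_pure_m[of j] each m0 by (metis gr0I)
      have mj: "0 < expo m j" using not_pure_m[of i] each m0 by (metis gr0I)
      have m'0: "expo m' X1 = 0" using M'1 tm(2) by (simp add: lookup_add)
      have m'_eq: "m' = xpow l (expo m' l)"
        by (rule mon_eq_xpow) (metis each m'0 tm(3) mi mj less_numeral_extra(3))
      have wtm': "wt n m = expo m' l * n l" using wtm m'_eq by (metis wt_xpow)
      have "0 < expo m' l" using wtm' \<open>wt n m \<noteq> 0\<close> by (metis gr0I mult_0)
      then have al: "a l \<le> expo m' l" using a_min m0 wtm' by blast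
      show False
      proof (cases "l = X2")
        case True
        have "n X3 * mdeg m \<le> wt n m"
          by (rule wt_ge) (metis var.exhaust less_numeral_extra(3) m0 True incr(3) order.refl less_imp_le)
        moreover have "mdeg m \<noteq> 0" using mi by (metis mdeg_def sum_eq_0_iff finite_class.finite_UNIV UNIV_I less_numeral_extra(3))
        ultimately have "n X2 * mdeg m < wt n m" using incr(2)
          by (metis less_le_trans mult_less_cancel2 not_gr_zero)
        then have "mdeg m < expo m' l" using wtm' True
          by (metis mult.commute mult_less_cancel2)
        then have "mdeg m < mdeg m'" using m'_eq by (metis mdeg_xpow)
        then have "mdeg B < mdeg M'" using tm by simp
        then show False using deg_max[of M'] M' B_props by simp
      next
        case False
        then have "l = X3 \<or> l = X4" using l by (cases l) auto
        then have rl: "0 < expo (r l) X1" using r3 r4 by auto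
        obtain q where q: "m' = xpow l (a l) + q" using xpow_divides[OF al] .
        have "wt n (r l + q + t) = s" using tm(2) q r_wt M' B_props by simp
        moreover have "0 < expo (r l + q + t) X1" using rl by (simp add: lookup_add)
        ultimately have "expo B k = 0 \<or> expo (r l + q + t) k = 0" by (intro disj1)
        then show False using k tk by (simp add: lookup_add)
      qed
    qed
    \<comment> \<open>A multiple of \<open>x\<^sub>1\<close> or of \<open>x\<^sub>l\<close> is not \<open>B\<close>, so isolation excludes the variables of \<open>B\<close>.\<close>
    have disj: "expo Q i = 0" "expo Q j = 0" if "wt n Q = s" "0 < expo Q X1 \<or> 0 < expo Q l" for Q
    proof -
      have "Q \<noteq> B" using that B_props l by auto
      then have "\<forall>i. expo B i = 0 \<or> expo Q i = 0" using iso that B_props unfolding isolated_def by auto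
      then show "expo Q i = 0" "expo Q j = 0" using Bi Bj by (metis less_numeral_extra(3))+
    qed
    have l_occurs: "0 < expo Q l" if "0 < expo Q X1" "wt n Q = s" for Q
    proof (rule ccontr)
      assume *: "\<not> 0 < expo Q l"
      have "expo Q k = 0" if "k \<noteq> X1" for k
        using each[of k] that * disj[of Q] \<open>0 < expo Q X1\<close> \<open>wt n Q = s\<close> by auto
      then show False using x1_dominated_of_pure[of Q B] that B_props by auto
    qed
    \<comment> \<open>Replacing \<open>x\<^sub>l\<close> to the power \<open>a l\<close> stays in the fibre and cannot produce variables of \<open>B\<close>,
      which leaves only \<open>x\<^sub>1\<close>.\<close>
    have rl_pure: "\<exists>c. r l = xpow X1 c \<and> c * n X1 = a l * n l \<and> a X1 \<le> c"
      if "wt n (r l + Q) = s" "0 < expo Q X1 \<or> 0 < expo Q l" for Q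
    proof -
      have "expo (r l) i = 0" "expo (r l) j = 0" using disj[OF that(1)] that(2) by (auto simp: lookup_add)
      then have eq: "r l = xpow X1 (expo (r l) X1)"
        by (intro mon_eq_xpow) (metis each r_supp)
      then have w: "expo (r l) X1 * n X1 = a l * n l" by (metis r_wt wt_xpow)
      moreover have "0 < expo (r l) X1" using w a_pos[of l] n_gt0[of l] by (metis gr0I mult_0 mult_is_0 less_numeral_extra(3))
      moreover have "wt n (xpow l (a l)) = expo (r l) X1 * n X1" using w by simp
      moreover have "expo (xpow l (a l)) X1 = 0" using l by (simp add: lookup_single)
      ultimately have "a X1 \<le> expo (r l) X1" by (metis a_min)
      then show ?thesis using eq w by blast
    qed
    \<comment> \<open>Otherwise the critical replacement of \<open>x\<^sub>1\<close> is a power of \<open>x\<^sub>l\<close> with exponent above \<open>a l\<close>, by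
      \<open>case1\<close>, and replacing \<open>x\<^sub>l\<close> in turn gives a power of \<open>x\<^sub>1\<close> whose weight is at once at least
      \<open>a X1 * n X1\<close> and smaller than that.\<close>
    have p_small: "expo Q X1 < a X1" if Q: "0 < expo Q X1" "wt n Q = s" for Q
    proof (rule ccontr)
      assume "\<not> expo Q X1 < a X1"
      then obtain Q0 where Q0: "Q = xpow X1 (a X1) + Q0" using xpow_divides[of "a X1" Q X1] by auto
      have Q0l: "0 < expo Q0 l" using l_occurs[OF Q] Q0 l by (simp add: lookup_add lookup_single)
      have "wt n (r X1 + Q0) = s" using Q Q0 r_wt by simp
      with disj[OF this] Q0l have "expo (r X1) i = 0" "expo (r X1) j = 0" by (auto simp: lookup_add)
      then have eq: "r X1 = xpow l (expo (r X1) l)"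
        by (intro mon_eq_xpow) (metis each r_supp)
      define c where "c = expo (r X1) l"
      have w: "c * n l = a X1 * n X1" using eq c_def by (metis r_wt wt_xpow)
      have "0 < c" using w a_pos[of X1] n_pos by (metis gr0I mult_0 mult_is_0 less_numeral_extra(3))
      moreover have "wt n (xpow X1 (a X1)) = c * n l" using w by simp
      moreover have "expo (xpow X1 (a X1)) l = 0" using l by (simp add: lookup_single)
      ultimately have "a l \<le> c" by (metis a_min)
      moreover have "a l \<noteq> c" using case1[of l X1] l w by auto
      ultimately have lc: "a l < c" by simp
      then have "xpow l c = xpow l (a l) + xpow l (c - a l)" by (simp add: single_add[symmetric])
      then have "wt n (r l + (xpow l (c - a l) + Q0)) = s"
        using Q Q0 eq c_def r_wt[of X1] r_wt[of l] by (metis add.assoc wt_add wt_xpow)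
      moreover have "0 < expo (xpow l (c - a l) + Q0) l" using Q0l by (simp add: lookup_add)
      ultimately obtain c' where "c' * n X1 = a l * n l" "a X1 \<le> c'" using rl_pure by blast
      then have "c * n l \<le> a l * n l" using w by (metis mult_le_mono1)
      then show False using lc n_gt0[of l] by simp
    qed
    \<comment> \<open>Otherwise replacing \<open>x\<^sub>l\<close> raises the exponent of \<open>x\<^sub>1\<close> above what \<open>p_small\<close> permits.\<close>
    have q_small: "expo P l < a l"
    proof (rule ccontr)
      assume "\<not> expo P l < a l"
      then obtain P0 where P0: "P = xpow l (a l) + P0" using xpow_divides[of "a l" P l] by auto
      have P01: "0 < expo P0 X1" using less.prems(2) P0 l by (simp add: lookup_add lookup_single)
      have w: "wt n (r l + P0) = s" using P0 wtP r_wt by simp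
      with rl_pure[OF w] P01 obtain c where "r l = xpow X1 c" "a X1 \<le> c" by blast
      then have "a X1 \<le> expo (r l + P0) X1" by (simp add: lookup_add)
      moreover have "0 < expo (r l + P0) X1" using P01 by (simp add: lookup_add)
      ultimately show False using p_small[OF _ w] by simp
    qed
    have P_eq: "P = xpow X1 (expo P X1) + xpow l (expo P l)"
      by (rule mon_eq_xpow2[OF l(1)[symmetric]]) (metis each disj[OF wtP] less.prems(2))
    have "mdeg B \<le> mdeg P"
      using binom[OF ij(1,5,6) less.prems(2) p_small[OF less.prems(2) wtP] l_occurs[OF less.prems(2) wtP] q_small Bi Bj]
        P_eq B_eq iso wtP B_props by metis
    then show False using B_props less.prems wtP by (auto simp: x1_dominated_def)
  qed
qed

end

section \<open>Linear extension of maps on monomials\<close>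

text \<open>
  The parametrization, the substitution \<open>x\<^sub>2 = x\<^sub>3 = x\<^sub>4 = 0\<close> and the projection to the tangent cone
  are all linear maps into polynomials in one variable, determined by their values on monomials. Only
  the first two are ring homomorphisms.
\<close>
definition linext :: "(mon \<Rightarrow> 'k::field poly) \<Rightarrow> 'k pol \<Rightarrow> 'k poly" where
  "linext E f = (\<Sum>u \<in> Poly_Mapping.keys f. smult (Poly_Mapping.lookup f u) (E u))"

lemma linext_superset:
  assumes "finite A" "Poly_Mapping.keys f \<subseteq> A"
  shows "linext E f = (\<Sum>u \<in> A. smult (Poly_Mapping.lookup f u) (E u))"
  unfolding linext_def using assms by (intro sum.mono_neutral_left) (auto simp: in_keys_iff)

lemma linext_zero [simp]: "linext E 0 = 0"
  by (simp add: linext_def)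

lemma linext_add: "linext E (f + g) = linext E f + linext E g"
proof -
  let ?A = "Poly_Mapping.keys f \<union> Poly_Mapping.keys g"
  have "Poly_Mapping.keys (f + g) \<subseteq> ?A" by (rule keys_add)
  then show ?thesis
    by (simp add: linext_superset[of ?A] lookup_add smult_add_left sum.distrib)
qed

lemma linext_single [simp]: "linext E (Poly_Mapping.single u c) = smult c (E u)"
  by (simp add: linext_superset[of "{u}"])

lemma linext_sum: "linext E (sum f A) = (\<Sum>x\<in>A. linext E (f x))"
  by (induction A rule: infinite_finite_induct) (simp_all add: linext_add)

lemma linext_uminus: "linext E (- f) = - linext E f"
  by (metis add.right_inverse linext_add linext_zero minus_unique)

lemma linext_diff: "linext E (f - g) = linext E f - linext E g"
  by (metis diff_conv_add_uminus linext_add linext_uminus)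

lemma pol_eq_sum: "f = (\<Sum>u \<in> Poly_Mapping.keys f. Poly_Mapping.single u (Poly_Mapping.lookup f u))"
  by (intro poly_mapping_eqI)
    (simp add: lookup_sum lookup_single when_def sum.delta in_keys_iff)

lemma coeff_linext: "coeff (linext E f) s = (\<Sum>u \<in> Poly_Mapping.keys f. Poly_Mapping.lookup f u * coeff (E u) s)"
  by (simp add: linext_def coeff_sum)

lemma smult_sum_right: "smult c (sum f A) = (\<Sum>x\<in>A. smult c (f x))"
  by (induction A rule: infinite_finite_induct) (simp_all add: smult_add_right)

lemma linext_single_mult: "linext E (Poly_Mapping.single t c * f) = smult c (linext (\<lambda>u. E (t + u)) f)"
proof -
  have "Poly_Mapping.single t c * f =
      (\<Sum>u \<in> Poly_Mapping.keys f. Poly_Mapping.single (t + u) (c * Poly_Mapping.lookup f u))"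
    by (subst pol_eq_sum[of f]) (simp add: sum_distrib_left mult_single)
  then show ?thesis by (simp add: linext_sum smult_sum_right) (simp add: linext_def smult_sum_right)
qed

text \<open>
  With three different maps this covers both ring homomorphisms (\<open>E = E1 = E2\<close>) and maps that are
  linear over a subring containing \<open>f\<close>.
\<close>
lemma linext_mult:
  assumes "\<And>t u. t \<in> Poly_Mapping.keys f \<Longrightarrow> E (t + u) = E1 t * E2 u"
  shows "linext E (f * g) = linext E1 f * linext E2 g"
proof -
  have "f * g = (\<Sum>t \<in> Poly_Mapping.keys f. Poly_Mapping.single t (Poly_Mapping.lookup f t) * g)"
    by (subst pol_eq_sum[of f]) (simp add: sum_distrib_right)
  then have "linext E (f * g) = (\<Sum>t \<in> Poly_Mapping.keys f. smult (Poly_Mapping.lookup f t) (linext (\<lambda>u. E (t + u)) g))"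
    by (simp add: linext_sum linext_single_mult)
  also have "\<dots> = (\<Sum>t \<in> Poly_Mapping.keys f. smult (Poly_Mapping.lookup f t) (E1 t) * linext E2 g)"
  proof (rule sum.cong[OF refl])
    fix t assume "t \<in> Poly_Mapping.keys f"
    then have "linext (\<lambda>u. E (t + u)) g = E1 t * linext E2 g"
      by (simp add: linext_def assms sum_distrib_left)
    then show "smult (Poly_Mapping.lookup f t) (linext (\<lambda>u. E (t + u)) g) = smult (Poly_Mapping.lookup f t) (E1 t) * linext E2 g"
      by simp
  qed
  finally show ?thesis by (simp add: linext_def sum_distrib_right)
qed

text \<open>
  Serves in two ways: with \<open>\<rho> i = x\<^sub>1\<^sup>i\<close> it embeds polynomials in \<open>x\<^sub>1\<close> into the ring in four
  variables, and with \<open>\<rho> s\<close> of weight \<open>s\<close> and greatest degree it gives normal forms in the tangent cone.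
\<close>
definition lift_poly :: "(nat \<Rightarrow> mon) \<Rightarrow> 'k::field poly \<Rightarrow> 'k pol" where
  "lift_poly \<rho> p = (\<Sum>i \<le> degree p. Poly_Mapping.single (\<rho> i) (coeff p i))"

lemma lift_poly_superset:
  "degree p \<le> m \<Longrightarrow> lift_poly \<rho> p = (\<Sum>i \<le> m. Poly_Mapping.single (\<rho> i) (coeff p i))"
  unfolding lift_poly_def by (intro sum.mono_neutral_left) (auto simp: coeff_eq_0)

lemma lift_poly_add: "lift_poly \<rho> (p + q) = lift_poly \<rho> p + lift_poly \<rho> q"
  by (simp add: lift_poly_superset[of _ "max (degree p) (degree q)"] degree_add_le single_add sum.distrib)

lemma lift_poly_zero [simp]: "lift_poly \<rho> 0 = 0"
  by (simp add: lift_poly_def)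

lemma lift_poly_monom: "lift_poly \<rho> (monom c s) = Poly_Mapping.single (\<rho> s) c"
proof -
  have "lift_poly \<rho> (monom c s) = (\<Sum>i\<le>s. if i = s then Poly_Mapping.single (\<rho> s) c else 0)"
    unfolding lift_poly_superset[OF degree_monom_le] by (intro sum.cong) auto
  then show ?thesis by simp
qed

lemma linext_lift_poly: "linext E (lift_poly \<rho> p) = (\<Sum>i \<le> degree p. smult (coeff p i) (E (\<rho> i)))"
  by (simp add: lift_poly_def linext_sum)

lemma keys_lift_poly: "Poly_Mapping.keys (lift_poly \<rho> p) \<subseteq> range \<rho>"
  using keys_sum[of "\<lambda>i. Poly_Mapping.single (\<rho> i) (coeff p i)" "{..degree p}"]
  unfolding lift_poly_def by (auto split: if_splits)

section \<open>Polynomials in one variable modulo a nonzero polynomial\<close>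

text \<open>A nonzero combination of least degree divides all combinations.\<close>
lemma poly_bezout:
  fixes p y :: "'k::field poly"
  assumes "p \<noteq> 0"
  obtains d s t where "d = s * y + t * p" "d dvd y" "d dvd p" "d \<noteq> 0"
proof -
  define S where "S = {d. d \<noteq> 0 \<and> (\<exists>s t. d = s * y + t * p)}"
  have "p = 0 * y + 1 * p" by simp
  then have "p \<in> S" using assms unfolding S_def by blast
  then obtain d where d: "d \<in> S" "\<And>e. e \<in> S \<Longrightarrow> degree d \<le> degree e"
    using ex_has_least_nat[of "\<lambda>d. d \<in> S" p degree] by blast
  then obtain s t where st: "d = s * y + t * p" "d \<noteq> 0" by (auto simp: S_def)
  have dvd: "d dvd a * y + b * p" for a b
  proof -
    let ?x = "a * y + b * p"
    define q where "q = ?x div d"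
    have "?x mod d = ?x - q * d" by (simp add: q_def minus_div_mult_eq_mod)
    also have "q * d = q * s * y + q * t * p" by (subst st(1)) (simp add: algebra_simps)
    finally have eq: "?x mod d = (a - q * s) * y + (b - q * t) * p" by (simp add: algebra_simps)
    show ?thesis
    proof (rule ccontr)
      assume "\<not> d dvd ?x"
      then have ne: "?x mod d \<noteq> 0" by (simp add: dvd_eq_mod_eq_0)
      then have "?x mod d \<in> S" using eq unfolding S_def by blast
      moreover have "degree (?x mod d) < degree d" using degree_mod_less[OF st(2), of ?x] ne by simp
      ultimately show False using d(2) by fastforce
    qed
  qed
  show thesis using that[OF st(1)] dvd[of 1 0] dvd[of 0 1] st(2) by simp
qed

text \<open>
  By induction on the degree of \<open>p\<close>: if \<open>p\<close> and \<open>y\<close> are coprime, a Bezout identity gives the claim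
  with \<open>k = 0\<close>; a common factor is removed from \<open>p\<close> at the price of another factor \<open>y\<close>.
\<close>
lemma poly_zero_dim:
  fixes p y :: "'k::field poly"
  assumes "p \<noteq> 0" shows "\<exists>k r c. y ^ k * (1 - y * r) = p * c"
  using assms
proof (induction "degree p" arbitrary: p rule: less_induct)
  case less
  obtain d s t where d: "d = s * y + t * p" "d dvd y" "d dvd p" "d \<noteq> 0"
    using poly_bezout[OF less.prems] .
  show ?case
  proof (cases "degree d = 0")
    case True
    then obtain c where c: "d = [:c:]" "c \<noteq> 0" using d(4) by (metis degree_eq_zeroE pCons_0_0)
    have "1 = smult (inverse c) d" using c by (simp add: one_pCons)
    also have "\<dots> = smult (inverse c) s * y + smult (inverse c) t * p" 
      by (simp add: d(1) smult_add_right)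
    finally have "y ^ 0 * (1 - y * smult (inverse c) s) = p * smult (inverse c) t"
      by (simp add: algebra_simps)
    then show ?thesis by blast
  next
    case False
    obtain p' where p': "p = d * p'" using d(3) by blast
    obtain y' where y': "y = d * y'" using d(2) by blast
    have "p' \<noteq> 0" using p' less.prems by auto
    moreover have "degree p' < degree p" using False p' d(4) calculation by (simp add: degree_mult_eq)
    ultimately obtain k r c where IH: "y ^ k * (1 - y * r) = p' * c" using less.hyps by blast
    have "y ^ Suc k * (1 - y * r) = y * (y ^ k * (1 - y * r))" by simp
    also have "\<dots> = p * (c * y')" unfolding IH by (simp add: p' y' algebra_simps)
    finally show ?thesis by blast
  qed
qed

section \<open>Three linear maps to polynomials in one variable\<close>

text \<open>The order of \<open>t\<^sup>s\<close> in the local ring of the curve.\<close>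
definition max_deg :: "(var \<Rightarrow> nat) \<Rightarrow> nat \<Rightarrow> nat" where
  "max_deg n s = Max (mdeg ` {u. wt n u = s})"

text \<open>The image of \<open>x\<^sup>u\<close> in the tangent cone, written as \<open>t\<close> to its weight.\<close>
definition top_eval :: "(var \<Rightarrow> nat) \<Rightarrow> mon \<Rightarrow> 'k::field poly" where
  "top_eval n u = (if mdeg u = max_deg n (wt n u) then monom 1 (wt n u) else 0)"

definition x1_eval :: "mon \<Rightarrow> 'k::field poly" where
  "x1_eval u = (if \<forall>i. i \<noteq> X1 \<longrightarrow> expo u i = 0 then monom 1 (expo u X1) else 0)"

lemma x1_eval_add: "x1_eval (u + v) = x1_eval u * (x1_eval v :: 'k::field poly)"
  by (auto simp: x1_eval_def lookup_add mult_monom)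

lemma linext_x1_eval_mult: "linext x1_eval (f * g) = linext x1_eval f * (linext x1_eval g :: 'k::field poly)"
  by (rule linext_mult) (rule x1_eval_add)

lemma linext_x1_eval_one: "linext x1_eval 1 = (1 :: 'k::field poly)"
  using linext_single[of x1_eval 0 1] by (simp add: x1_eval_def one_pCons)

lemma linext_x1_eval_power: "linext x1_eval (f ^ k) = (linext x1_eval f ^ k :: 'k::field poly)"
  by (induction k) (simp_all add: linext_x1_eval_one linext_x1_eval_mult)

lemma linext_x1_eval_lift_poly: "linext x1_eval (lift_poly (xpow X1) p) = (p :: 'k::field poly)"
proof -
  have "x1_eval (xpow X1 i) = (monom 1 i :: 'k poly)" for i
    by (simp add: x1_eval_def lookup_single)
  then show ?thesis by (simp add: linext_lift_poly smult_monom poly_as_sum_of_monoms)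
qed

text \<open>So the substitution \<open>x\<^sub>2 = x\<^sub>3 = x\<^sub>4 = 0\<close> vanishes exactly on polynomials without pure powers of \<open>x\<^sub>1\<close>.\<close>
lemma coeff_linext_x1_eval: "coeff (linext x1_eval f :: 'k::field poly) k = Poly_Mapping.lookup f (xpow X1 k)"
proof -
  have *: "coeff (x1_eval u :: 'k poly) k = (if u = xpow X1 k then 1 else 0)" for u
  proof (cases "\<forall>i. i \<noteq> X1 \<longrightarrow> expo u i = 0")
    case True
    then have "u = xpow X1 (expo u X1)" by (intro mon_eq_xpow) auto
    then have "u = xpow X1 k \<longleftrightarrow> expo u X1 = k" by (metis lookup_single_eq)
    then show ?thesis using True by (simp add: x1_eval_def)
  next
    case False
    then have "u \<noteq> xpow X1 k" by (auto simp: lookup_single)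
    then show ?thesis using False by (auto simp: x1_eval_def)
  qed
  show ?thesis
    by (simp add: coeff_linext * if_distrib[of "\<lambda>x. _ * x"] sum.delta in_keys_iff cong: if_cong)
qed

lemma param_map_linext: "param_map n f = linext (\<lambda>u. monom 1 (wt n u)) f"
proof -
  have "(\<Prod>i\<in>UNIV. monom (1::'a) (n i) ^ expo u i) = monom 1 (wt n u)" for u
    by (simp add: wt_def sum_var UNIV_var monom_power mult_monom mult.commute add.assoc)
  then show ?thesis by (simp add: param_map_def linext_def)
qed

lemma curve_ideal_iff: "f \<in> curve_ideal K n \<longleftrightarrow> linext (\<lambda>u. monom 1 (wt n u)) f = 0"
  by (simp add: curve_ideal_def param_map_linext)

lemma binomial_in_curve_ideal:
  "mono_pol u - mono_pol v \<in> curve_ideal (K :: 'k::field itself) n \<longleftrightarrow> wt n u = wt n v"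
proof -
  have "monom (1::'k) a = monom 1 b \<longleftrightarrow> a = b" for a b
    by (metis degree_monom_eq one_neq_zero)
  then show ?thesis by (simp add: curve_ideal_iff linext_diff)
qed

section \<open>The ideal of initial forms\<close>
context positive_weights
begin

lemma finite_fibre_degrees: "finite (mdeg ` {u. wt n u = s})"
  by (rule finite_subset[of _ "{..s}"]) (auto simp: mdeg_le_wt)

lemma mdeg_le_max_deg: "mdeg u \<le> max_deg n (wt n u)"
  unfolding max_deg_def using finite_fibre_degrees by (intro Max_ge) auto

definition top_mon :: "nat \<Rightarrow> mon" where
  "top_mon s = (SOME u. wt n u = s \<and> mdeg u = max_deg n s)"

lemma top_mon: "wt n (top_mon (wt n u)) = wt n u" "mdeg (top_mon (wt n u)) = max_deg n (wt n u)"
proof -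
  have "max_deg n (wt n u) \<in> mdeg ` {v. wt n v = wt n u}"
    unfolding max_deg_def using finite_fibre_degrees by (intro Max_in) auto
  then have "\<exists>v. wt n v = wt n u \<and> mdeg v = max_deg n (wt n u)" by auto
  then show "wt n (top_mon (wt n u)) = wt n u" "mdeg (top_mon (wt n u)) = max_deg n (wt n u)"
    unfolding top_mon_def by (rule someI2_ex, simp)+
qed

lemma coeff_top_eval:
  "coeff (top_eval n u :: 'k::field poly) s = (if wt n u = s \<and> mdeg u = max_deg n s then 1 else 0)"
  by (auto simp: top_eval_def)

lemma max_deg_superadd: "max_deg n (wt n u) + max_deg n (wt n v) \<le> max_deg n (wt n u + wt n v)"
  using mdeg_le_max_deg[of "top_mon (wt n u) + top_mon (wt n v)"] by (simp add: top_mon)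

text \<open>A description of \<open>I(C)\<^sub>*\<close> by linear conditions; see \<open>initial_ideal_eq\<close>.\<close>
definition tangent_ideal :: "'k::field pol set" where
  "tangent_ideal = {f. linext (top_eval n) f = 0}"

text \<open>
  Multiplication by \<open>x\<^sup>t\<close> shifts the fibre of \<open>s'\<close> into that of \<open>s = s' + wt t\<close>. By superadditivity of
  the greatest degree it either maps monomials of greatest degree to monomials of greatest degree or maps
  none to such.
\<close>
lemma tangent_ideal_is_ideal: "ideal (tangent_ideal :: 'k::field pol set) pol_ring"
proof -
  have single: "linext (top_eval n) (Poly_Mapping.single t c * f) = 0"
    if f: "linext (top_eval n) f = 0" for t c and f :: "'k pol"
  proof -
    have "coeff (linext (\<lambda>u. top_eval n (t + u)) f) s = 0" for s
    proof (cases "wt n t \<le> s")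
      case False
      then show ?thesis by (simp add: coeff_linext coeff_top_eval)
    next
      case True
      define s' where "s' = s - wt n t"
      have s: "s = wt n t + s'" using True by (simp add: s'_def)
      show ?thesis
      proof (cases "mdeg t + max_deg n s' = max_deg n s")
        case True
        then have "coeff (top_eval n (t + u) :: 'k poly) s = coeff (top_eval n u) s'" for u
          by (auto simp: coeff_top_eval s)
        then have "coeff (linext (\<lambda>u. top_eval n (t + u)) f) s = coeff (linext (top_eval n) f) s'"
          by (simp add: coeff_linext)
        then show ?thesis using f by simp
      next
        case False
        have "\<not> (wt n (t + u) = s \<and> mdeg (t + u) = max_deg n s)" for u
        proof
          assume *: "wt n (t + u) = s \<and> mdeg (t + u) = max_deg n s"
          then have "wt n u = s'" by (simp add: s)
          then have "mdeg u \<le> max_deg n s'" "max_deg n (wt n t) + max_deg n s' \<le> max_deg n s"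
            using mdeg_le_max_deg[of u] max_deg_superadd[of t u] by (auto simp: s)
          then show False using False * mdeg_le_max_deg[of t] by simp
        qed
        then have "coeff (top_eval n (t + u) :: 'k poly) s = 0" for u unfolding coeff_top_eval by simp
        then show ?thesis by (simp add: coeff_linext)
      qed
    qed
    then have "linext (\<lambda>u. top_eval n (t + u)) f = 0" by (simp add: poly_eq_iff)
    then show ?thesis by (simp add: linext_single_mult)
  qed
  have "linext (top_eval n) (h * f) = 0" if "linext (top_eval n) f = 0" for h f :: "'k pol"
  proof -
    have "h * f = (\<Sum>t \<in> Poly_Mapping.keys h. Poly_Mapping.single t (Poly_Mapping.lookup h t) * f)"
      by (subst pol_eq_sum[of h]) (simp add: sum_distrib_right)
    then show ?thesis using single[OF that] by (simp add: linext_sum)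
  qed
  then show ?thesis by (simp add: ideal_type_ring_iff tangent_ideal_def linext_add)
qed

text \<open>
  A monomial of least degree in \<open>f\<close> can have the greatest degree in its fibre only if all monomials of
  \<open>f\<close> in that fibre have that degree. The condition on the fibre is then the one for \<open>f \<in> I(C)\<close>.
\<close>
lemma initial_form_in_tangent_ideal:
  assumes f: "f \<in> curve_ideal K n" shows "initial_form f \<in> (tangent_ideal :: 'k::field pol set)"
proof -
  let ?low = "{u \<in> Poly_Mapping.keys f. mdeg u = least_degree f}"
  have least: "least_degree f \<le> mdeg u" if "u \<in> Poly_Mapping.keys f" for u
    unfolding least_degree_def using that by (intro Min_le) auto
  have linext_f: "linext (\<lambda>u. monom 1 (wt n u)) f = 0" using f by (simp add: curve_ideal_iff)
  have "coeff (linext (top_eval n) (initial_form f)) s = 0" for s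
  proof -
    have "linext (top_eval n) (initial_form f) = (\<Sum>u \<in> ?low. smult (Poly_Mapping.lookup f u) (top_eval n u))"
      by (simp add: initial_form_def linext_sum)
    then have *: "coeff (linext (top_eval n) (initial_form f)) s
        = (\<Sum>u \<in> ?low. Poly_Mapping.lookup f u * coeff (top_eval n u) s)"
      by (simp add: coeff_sum)
    show ?thesis
    proof (cases "least_degree f = max_deg n s")
      case False
      then show ?thesis unfolding * coeff_top_eval by (intro sum.neutral) auto
    next
      case True
      have "(\<Sum>u \<in> ?low. Poly_Mapping.lookup f u * coeff (top_eval n u) s)
        = (\<Sum>u \<in> Poly_Mapping.keys f. Poly_Mapping.lookup f u * coeff (monom 1 (wt n u)) s)"
      proof (rule sum.mono_neutral_cong_left)
        show "\<forall>i\<in>Poly_Mapping.keys f - ?low. Poly_Mapping.lookup f i * coeff (monom 1 (wt n i)) s = 0"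
        proof
          fix u assume u: "u \<in> Poly_Mapping.keys f - ?low"
          have "wt n u \<noteq> s"
            using u least[of u] mdeg_le_max_deg[of u] True by auto
          then show "Poly_Mapping.lookup f u * coeff (monom 1 (wt n u)) s = 0" by simp
        qed
      qed (auto simp: coeff_top_eval True)
      also have "\<dots> = 0" using linext_f by (metis coeff_linext coeff_0)
      finally show ?thesis using * by simp
    qed
  qed
  then show ?thesis by (simp add: tangent_ideal_def poly_eq_iff)
qed

text \<open>
  Modulo initial forms of binomials, a monomial equals the chosen monomial of greatest degree in its
  fibre if it has that degree itself, and zero otherwise. Reducing \<open>f\<close> in this way leaves the
  combination of chosen monomials whose coefficients are those of \<open>linext (top_eval n) f\<close>.
\<close>
lemma tangent_ideal_subset_initial_ideal: "(tangent_ideal :: 'k::field pol set) \<subseteq> initial_ideal (curve_ideal (K :: 'k itself) n)"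
proof
  let ?I = "curve_ideal K n" and ?in = "initial_ideal (curve_ideal K n)"
  interpret T: cring "pol_ring :: 'k pol ring" by (rule cring_from_type_algebra)
  have in_ideal: "ideal ?in pol_ring"
    unfolding initial_ideal_def by (rule T.genideal_ideal) simp
  have gen: "initial_form f \<in> ?in" if "f \<in> ?I" for f
    unfolding initial_ideal_def using T.genideal_self[of "initial_form ` ?I"] that by auto
  have closed: "0 \<in> ?in" "\<And>x y. x \<in> ?in \<Longrightarrow> y \<in> ?in \<Longrightarrow> x + y \<in> ?in"
    using in_ideal unfolding ideal_type_ring_iff by auto
  have binom: "Poly_Mapping.single u c - (if mdeg u = mdeg v then Poly_Mapping.single v c else 0) \<in> ?in"
    if uv: "wt n u = wt n v" "mdeg u \<le> mdeg v" for u v and c :: 'k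
  proof (cases "c = 0 \<or> u = v")
    case True
    then show ?thesis using closed(1) by auto
  next
    case False
    define f where "f = Poly_Mapping.single u c - Poly_Mapping.single v c"
    have "f \<in> ?I" using uv by (simp add: f_def curve_ideal_iff linext_diff)
    then have init: "initial_form f \<in> ?in" by (rule gen)
    have look: "Poly_Mapping.lookup f w = (if w = u then c else if w = v then - c else 0)" for w
      using False by (auto simp: f_def lookup_minus lookup_single when_def)
    then have keys: "Poly_Mapping.keys f = {u, v}" using False by (auto simp: in_keys_iff split: if_splits)
    have "least_degree f = mdeg u" using uv by (simp add: least_degree_def keys)
    then have "{w \<in> Poly_Mapping.keys f. mdeg w = least_degree f} = (if mdeg u = mdeg v then {u, v} else {u})"
      by (auto simp: keys)
    then have "initial_form f = Poly_Mapping.single u c - (if mdeg u = mdeg v then Poly_Mapping.single v c else 0)"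
      using False by (auto simp: initial_form_def look single_uminus)
    then show ?thesis using init by simp
  qed
  have red: "f - lift_poly top_mon (linext (top_eval n) f) \<in> ?in" for f :: "'k pol"
  proof -
    define red where "red f = f - lift_poly top_mon (linext (top_eval n) f)" for f :: "'k pol"
    have red_add: "red (f + g) = red f + red g" for f g
      by (simp add: red_def linext_add lift_poly_add)
    have red_zero: "red 0 = 0" by (simp add: red_def)
    have single: "red (Poly_Mapping.single u c) \<in> ?in" for u c
    proof -
      have "lift_poly top_mon (smult c (top_eval n u)) =
          (if mdeg u = mdeg (top_mon (wt n u)) then Poly_Mapping.single (top_mon (wt n u)) c else 0)"
        by (simp add: top_eval_def smult_monom lift_poly_monom top_mon)
      then show ?thesis using binom[of u "top_mon (wt n u)" c] mdeg_le_max_deg[of u]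
        by (simp add: red_def top_mon)
    qed
    have "red (\<Sum>u\<in>A. Poly_Mapping.single u (Poly_Mapping.lookup f u)) \<in> ?in" if "finite A" for A
      using that by (induction A) (simp_all add: red_zero red_add closed single)
    from this[of "Poly_Mapping.keys f"] show ?thesis
      using pol_eq_sum[of f] by (simp add: red_def)
  qed
  fix f :: "'k pol" assume "f \<in> tangent_ideal"
  then show "f \<in> ?in" using red[of f] by (simp add: tangent_ideal_def)
qed

lemma initial_ideal_eq: "initial_ideal (curve_ideal (K :: 'k::field itself) n) = tangent_ideal"
proof
  interpret T: cring "pol_ring :: 'k pol ring" by (rule cring_from_type_algebra)
  show "initial_ideal (curve_ideal K n) \<subseteq> tangent_ideal"
    unfolding initial_ideal_def using initial_form_in_tangent_ideal by (intro T.genideal_minimal tangent_ideal_is_ideal) auto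
qed (rule tangent_ideal_subset_initial_ideal)

definition x1_part_zero :: "'k::field pol set" where
  "x1_part_zero = {f. linext x1_eval f = 0}"

lemma x1_part_zero_primeideal: "primeideal (x1_part_zero :: 'k::field pol set) pol_ring"
proof (rule primeidealI)
  show "ideal (x1_part_zero :: 'k pol set) pol_ring"
    by (simp add: ideal_type_ring_iff x1_part_zero_def linext_add linext_x1_eval_mult)
  have "(1 :: 'k pol) \<notin> x1_part_zero" by (simp add: x1_part_zero_def linext_x1_eval_one)
  then show "carrier pol_ring \<noteq> (x1_part_zero :: 'k pol set)" by auto
qed (auto simp: x1_part_zero_def linext_x1_eval_mult cring_from_type_algebra)

text \<open>
  Every other monomial of the weight of \<open>x\<^sub>1\<^sup>k\<close> has smaller degree, since \<open>n\<^sub>1\<close> is the smallest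
  weight. Hence no power of \<open>x\<^sub>1\<close> vanishes in the tangent cone.
\<close>
lemma max_deg_pure: "wt n u = k * n X1 \<and> mdeg u = max_deg n (k * n X1) \<longleftrightarrow> u = xpow X1 k"
proof
  assume *: "wt n u = k * n X1 \<and> mdeg u = max_deg n (k * n X1)"
  have "k \<le> mdeg u" using mdeg_le_max_deg[of "xpow X1 k"] * by simp
  then have le: "wt n u \<le> n X1 * mdeg u" using * by simp
  have "expo u i = 0" if "i \<noteq> X1" for i
  proof (rule ccontr)
    assume "expo u i \<noteq> 0"
    then obtain u0 where u0: "u = xpow i 1 + u0" using xpow_divides[of 1 u i] by auto
    have "n X1 * mdeg u0 \<le> wt n u0" by (rule wt_ge) (metis n_gt1 less_imp_le order.refl)
    then show False using le n_gt1[OF that] by (simp add: u0)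
  qed
  then have "u = xpow X1 (expo u X1)" by (intro mon_eq_xpow)
  moreover from this have "expo u X1 * n X1 = k * n X1" using * by (metis wt_xpow)
  ultimately show "u = xpow X1 k" using n_pos by simp
next
  assume u: "u = xpow X1 k"
  have "n X1 * max_deg n (k * n X1) \<le> k * n X1"
    using wt_ge[of "top_mon (k * n X1)" "n X1" n] top_mon[of "xpow X1 k"]
    by (metis n_gt1 less_imp_le order.refl wt_xpow)
  then have "max_deg n (k * n X1) \<le> k" using n_pos by (simp add: mult.commute)
  then show "wt n u = k * n X1 \<and> mdeg u = max_deg n (k * n X1)"
    using u mdeg_le_max_deg[of "xpow X1 k"] by simp
qed

lemma tangent_ideal_subset_x1_part_zero: "(tangent_ideal :: 'k::field pol set) \<subseteq> x1_part_zero"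
proof
  fix f :: "'k pol" assume f: "f \<in> tangent_ideal"
  have "coeff (linext x1_eval f) k = 0" for k
  proof -
    have "coeff (linext (top_eval n) f) (k * n X1) =
       (\<Sum>u \<in> Poly_Mapping.keys f. Poly_Mapping.lookup f u * (if u = xpow X1 k then 1 else 0))"
      by (simp only: coeff_linext coeff_top_eval max_deg_pure)
    also have "\<dots> = Poly_Mapping.lookup f (xpow X1 k)"
      by (simp add: if_distrib[of "\<lambda>x. _ * x"] in_keys_iff cong: if_cong)
    finally show ?thesis using f by (simp add: coeff_linext_x1_eval tangent_ideal_def)
  qed
  then show "f \<in> x1_part_zero" by (simp add: x1_part_zero_def poly_eq_iff)
qed

text \<open>
  The power of \<open>x\<^sub>i\<close> with exponent \<open>n\<^sub>1\<close> has the weight of the power of \<open>x\<^sub>1\<close> with the larger exponent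
  \<open>n\<^sub>i\<close>.
\<close>
lemma large_power_top_eval:
  assumes "i \<noteq> X1" "n X1 \<le> expo u i" shows "top_eval n u = 0"
proof -
  obtain u0 where u0: "u = xpow i (n X1) + u0" using xpow_divides[OF assms(2)] .
  have "mdeg (xpow X1 (n i) + u0) \<le> max_deg n (wt n u)"
    using mdeg_le_max_deg[of "xpow X1 (n i) + u0"] by (simp add: u0 mult.commute)
  then have "mdeg u \<noteq> max_deg n (wt n u)" using n_gt1[OF assms(1)] by (simp add: u0)
  then show ?thesis by (simp add: top_eval_def)
qed

text \<open>
  The monomials of \<open>f\<^sup>k\<close> have degree at least \<open>k\<close> in \<open>x\<^sub>2, x\<^sub>3, x\<^sub>4\<close>; for \<open>k = 3 n\<^sub>1\<close> one of these
  variables has exponent at least \<open>n\<^sub>1\<close>.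
\<close>
lemma x1_part_zero_nilpotent:
  assumes f: "f \<in> x1_part_zero" shows "\<exists>k. f ^ k \<in> (tangent_ideal :: 'k::field pol set)"
proof -
  define d where "d u = expo u X2 + expo u X3 + expo u X4" for u
  have d1: "1 \<le> d u" if "u \<in> Poly_Mapping.keys f" for u
  proof (rule ccontr)
    assume *: "\<not> 1 \<le> d u"
    have "expo u i = 0" if "i \<noteq> X1" for i using * that by (cases i) (auto simp: d_def)
    then have "u = xpow X1 (expo u X1)" by (intro mon_eq_xpow)
    then have "Poly_Mapping.lookup f u = coeff (linext x1_eval f) (expo u X1)" by (metis coeff_linext_x1_eval)
    then show False using f that by (simp add: x1_part_zero_def in_keys_iff)
  qed
  have d_pow: "m \<le> d u" if "u \<in> Poly_Mapping.keys (f ^ m)" for u m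
    using that
  proof (induction m arbitrary: u)
    case (Suc m)
    then obtain v w where "u = v + w" "v \<in> Poly_Mapping.keys f" "w \<in> Poly_Mapping.keys (f ^ m)"
      using keys_mult[of f "f ^ m"] by auto
    then show ?case using d1[of v] Suc.IH[of w] by (simp add: d_def lookup_add)
  qed simp
  have "top_eval n u = (0 :: 'k poly)" if "u \<in> Poly_Mapping.keys (f ^ (3 * n X1))" for u
  proof -
    have "3 * n X1 \<le> d u" using d_pow[OF that] .
    then have "n X1 \<le> expo u X2 \<or> n X1 \<le> expo u X3 \<or> n X1 \<le> expo u X4" unfolding d_def by linarith
    then show ?thesis using large_power_top_eval by blast
  qed
  then have "f ^ (3 * n X1) \<in> tangent_ideal" by (simp add: tangent_ideal_def linext_def)
  then show ?thesis ..
qed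

end

section \<open>Domination makes the tangent cone Cohen-Macaulay\<close>
locale all_x1_dominated = positive_weights +
  assumes x1_dominated: "\<lbrakk>expo M X1 = 0; 0 < expo P X1; wt n P = wt n M\<rbrakk> \<Longrightarrow> x1_dominated n M"
begin

text \<open>
  Domination allows a monomial of greatest degree in the fibre of \<open>n\<^sub>1 + s\<close> to be chosen as a multiple of
  \<open>x\<^sub>1\<close>; dividing by \<open>x\<^sub>1\<close> lands in the fibre of \<open>s\<close>.
\<close>
lemma max_deg_shift: "max_deg n (n X1 + wt n u) = Suc (max_deg n (wt n u))"
proof (rule antisym)
  show "Suc (max_deg n (wt n u)) \<le> max_deg n (n X1 + wt n u)"
    using mdeg_le_max_deg[of "xpow X1 1 + top_mon (wt n u)"] by (simp add: top_mon)
  define M where "M = top_mon (wt n (xpow X1 1 + u))"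
  have M: "wt n M = n X1 + wt n u" "mdeg M = max_deg n (n X1 + wt n u)"
    using top_mon[of "xpow X1 1 + u"] by (simp_all add: M_def)
  have "\<exists>N. 0 < expo N X1 \<and> wt n N = wt n M \<and> mdeg M \<le> mdeg N"
  proof (cases "expo M X1 = 0")
    case True
    then show ?thesis using x1_dominated[of M "xpow X1 1 + u"] M by (auto simp: x1_dominated_def lookup_add)
  qed auto
  then obtain N where N: "0 < expo N X1" "wt n N = wt n M" "mdeg M \<le> mdeg N" by blast
  then obtain N0 where N0: "N = xpow X1 1 + N0" using xpow_divides[of 1 N X1] by auto
  then have "wt n N0 = wt n u" using N M by simp
  then show "max_deg n (n X1 + wt n u) \<le> Suc (max_deg n (wt n u))"
    using N N0 M mdeg_le_max_deg[of N0] by simp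
qed

lemma max_deg_shift_power: "max_deg n (k * n X1 + wt n u) = k + max_deg n (wt n u)"
proof (induction k)
  case (Suc k)
  then show ?case using max_deg_shift[of "xpow X1 k + u"] by (simp add: add.assoc)
qed simp

text \<open>Linearity of \<open>top_eval\<close> over \<open>k[x\<^sub>1]\<close>, where \<open>x\<^sub>1\<close> acts on \<open>k[t]\<close> as \<open>t\<close> to the power \<open>n\<^sub>1\<close>.\<close>
lemma top_eval_x1:
  assumes "\<And>i. i \<noteq> X1 \<Longrightarrow> expo t i = 0"
  shows "top_eval n (t + u) = monom 1 (expo t X1 * n X1) * (top_eval n u :: 'k::field poly)"
proof -
  have t: "t = xpow X1 (expo t X1)" using assms by (rule mon_eq_xpow)
  then have "wt n t = expo t X1 * n X1" "mdeg t = expo t X1" by (metis wt_xpow, metis mdeg_xpow)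
  then show ?thesis by (simp add: top_eval_def max_deg_shift_power mult_monom)
qed

text \<open>The polynomial in \<open>x\<^sub>1\<close> acts as multiplication by a nonzero element of the domain \<open>k[t]\<close>.\<close>
lemma x1_poly_regular:
  assumes p: "p \<noteq> 0" and g: "lift_poly (xpow X1) p * g \<in> tangent_ideal" shows "g \<in> (tangent_ideal :: 'k::field pol set)"
proof -
  let ?E = "\<lambda>t. monom 1 (expo t X1 * n X1) :: 'k poly"
  have "linext (top_eval n) (lift_poly (xpow X1) p * g) = linext ?E (lift_poly (xpow X1) p) * linext (top_eval n) g"
  proof (rule linext_mult, rule top_eval_x1)
    fix t i assume "t \<in> Poly_Mapping.keys (lift_poly (xpow X1) p)" "i \<noteq> X1"
    then show "expo t i = 0" using keys_lift_poly[of "xpow X1" p] by (auto simp: lookup_single)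
  qed
  moreover have "coeff (linext ?E (lift_poly (xpow X1) p)) (degree p * n X1) = lead_coeff p"
    using n_pos
    by (simp add: linext_lift_poly coeff_sum if_distrib[of "\<lambda>x. _ * x"] cong: if_cong)
  then have "linext ?E (lift_poly (xpow X1) p) \<noteq> 0" using p by (metis coeff_0 leading_coeff_0_iff)
  ultimately show ?thesis using g by (simp add: tangent_ideal_def)
qed

text \<open>
  Write \<open>f = F - b\<close> with \<open>F\<close> a nonzero polynomial in \<open>x\<^sub>1\<close> and \<open>b\<close> nilpotent modulo the ideal. As
  \<open>f\<close> divides \<open>F\<^sup>k - b\<^sup>k\<close>, the power \<open>F\<^sup>k\<close> annihilates what \<open>f\<close> annihilates.
\<close>
lemma non_x1_part_zero_regular:
  assumes f: "f \<notin> x1_part_zero" and g: "f * g \<in> tangent_ideal" shows "g \<in> (tangent_ideal :: 'k::field pol set)"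
proof -
  define p where "p = linext x1_eval f"
  define F where "F = lift_poly (xpow X1) p"
  have p: "p \<noteq> 0" using f by (simp add: p_def x1_part_zero_def)
  define b where "b = F - f"
  have "b \<in> x1_part_zero" by (simp add: x1_part_zero_def b_def F_def linext_diff linext_x1_eval_lift_poly p_def)
  then obtain k where k: "b ^ k \<in> tangent_ideal" using x1_part_zero_nilpotent by blast
  have tangent_ideal_mult: "c * x \<in> tangent_ideal" if "x \<in> tangent_ideal" for c x :: "'k pol"
    using tangent_ideal_is_ideal that by (auto simp: ideal_type_ring_iff)
  have "F - b dvd F ^ k - b ^ k" by (simp add: power_diff_sumr2)
  then obtain c where "F ^ k - b ^ k = f * c" by (auto simp: b_def)
  then have "F ^ k * g = c * (f * g) + g * b ^ k" by (simp add: algebra_simps)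
  then have "F ^ k * g \<in> tangent_ideal" using tangent_ideal_mult k g tangent_ideal_is_ideal by (auto simp: ideal_type_ring_iff)
  then show ?thesis
  proof (induction k arbitrary: g)
    case (Suc k)
    then have "F ^ k * g \<in> tangent_ideal" using x1_poly_regular[OF p, of "F ^ k * g"] by (simp add: F_def mult.assoc)
    then show ?case by (rule Suc.IH)
  qed simp
qed

text \<open>
  The relation holds in \<open>k[x\<^sub>1]\<close>. Its lift holds up to a nilpotent element, and taking a power of both
  sides preserves its shape because \<open>g\<close> divides \<open>1 - (1 - g r)\<^sup>m\<close>.
\<close>
lemma zero_dim_mod_tangent_ideal:
  assumes f: "f \<notin> x1_part_zero"
  shows "\<exists>k r c. g ^ k * (1 - g * r) - f * c \<in> (tangent_ideal :: 'k::field pol set)"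
proof -
  have "linext x1_eval f \<noteq> 0" using f by (simp add: x1_part_zero_def)
  then obtain k r c where eq: "linext x1_eval g ^ k * (1 - linext x1_eval g * r) = linext x1_eval f * c"
    using poly_zero_dim by blast
  define r' where "r' = lift_poly (xpow X1) r"
  define c' where "c' = lift_poly (xpow X1) c"
  define a where "a = g ^ k * (1 - g * r')"
  have "a - f * c' \<in> x1_part_zero"
    by (simp add: x1_part_zero_def a_def r'_def c'_def linext_diff linext_x1_eval_mult linext_x1_eval_power linext_x1_eval_one linext_x1_eval_lift_poly eq)
  then obtain m where m: "(a - f * c') ^ m \<in> tangent_ideal" using x1_part_zero_nilpotent by blast
  have "a - (a - f * c') dvd a ^ m - (a - f * c') ^ m" by (simp add: power_diff_sumr2)
  then obtain d where d: "a ^ m - (a - f * c') ^ m = f * c' * d" by auto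
  have "1 - (1 - g * r') dvd 1 ^ m - (1 - g * r') ^ m"
    unfolding power_diff_sumr2[of 1 m "1 - g * r'"] by (rule dvd_triv_left)
  then obtain e where e: "1 - (1 - g * r') ^ m = g * r' * e" by auto
  then have "(1 - g * r') ^ m = 1 - g * (r' * e)" by (simp add: algebra_simps)
  then have "a ^ m = g ^ (k * m) * (1 - g * (r' * e))" by (simp add: a_def power_mult_distrib power_mult)
  then have "g ^ (k * m) * (1 - g * (r' * e)) - f * (c' * d) = (a - f * c') ^ m"
    using d by (simp add: algebra_simps)
  then show ?thesis using m by metis
qed

text \<open>
  The image of \<open>L\<close> in \<open>k[t]\<close> is a module over \<open>k[t\<^bsup>n\<^sub>1\<^esup>]\<close>. Elements of least degree in each residue class
  modulo \<open>n\<^sub>1\<close> generate it, since they allow the leading term of any element to be cancelled.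
\<close>
lemma finitely_generated_mod_tangent_ideal:
  assumes L: "ideal L (pol_ring :: 'k::field pol ring)"
  shows "\<exists>A. finite A \<and> A \<subseteq> L \<and>
    (\<forall>L'. ideal L' pol_ring \<longrightarrow> tangent_ideal \<subseteq> L' \<longrightarrow> A \<subseteq> L' \<longrightarrow> L \<subseteq> L')"
proof -
  define \<psi> where "\<psi> f = (linext (top_eval n) f :: 'k poly)" for f
  define C where "C \<rho> = {f \<in> L. \<psi> f \<noteq> 0 \<and> degree (\<psi> f) mod n X1 = \<rho>}" for \<rho>
  have "\<exists>g. C \<rho> \<noteq> {} \<longrightarrow> g \<in> C \<rho> \<and> (\<forall>f \<in> C \<rho>. degree (\<psi> g) \<le> degree (\<psi> f))" for \<rho>
    using ex_has_least_nat[of "\<lambda>f. f \<in> C \<rho>" _ "\<lambda>f. degree (\<psi> f)"] by blast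
  then obtain g where g: "\<And>\<rho>. C \<rho> \<noteq> {} \<Longrightarrow> g \<rho> \<in> C \<rho>"
    and g_min: "\<And>\<rho> f. f \<in> C \<rho> \<Longrightarrow> degree (\<psi> (g \<rho>)) \<le> degree (\<psi> f)"
    by (metis empty_iff)
  define A where "A = g ` {\<rho> \<in> {..<n X1}. C \<rho> \<noteq> {}}"
  have A: "finite A" "A \<subseteq> L" using g by (auto simp: A_def C_def)
  have "f \<in> L'" if L': "ideal L' pol_ring" "tangent_ideal \<subseteq> L'" "A \<subseteq> L'" and f: "f \<in> L" for L' f
    using f
  proof (induction "degree (\<psi> f)" arbitrary: f rule: less_induct)
    case less
    show ?case
    proof (cases "\<psi> f = 0")
      case True
      then show ?thesis using L' by (auto simp: tangent_ideal_def \<psi>_def)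
    next
      case False
      define \<rho> where "\<rho> = degree (\<psi> f) mod n X1"
      have fC: "f \<in> C \<rho>" using less.prems False by (simp add: C_def \<rho>_def)
      then have gC: "g \<rho> \<in> C \<rho>" using g by blast
      then have gA: "g \<rho> \<in> A" using n_pos by (auto simp: A_def \<rho>_def)
      have gL: "g \<rho> \<in> L" and g0: "\<psi> (g \<rho>) \<noteq> 0" and "degree (\<psi> (g \<rho>)) mod n X1 = degree (\<psi> f) mod n X1"
        using gC by (auto simp: C_def \<rho>_def)
      then obtain k where k: "degree (\<psi> f) = k * n X1 + degree (\<psi> (g \<rho>))"
        using g_min[OF fC] by (metis le_add_diff_inverse2 mod_eq_dvd_iff_nat dvd_def mult.commute)
      define c where "c = lead_coeff (\<psi> f) / lead_coeff (\<psi> (g \<rho>))"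
      define h where "h = Poly_Mapping.single (xpow X1 k) c * g \<rho>"
      have "top_eval n (xpow X1 k + u) = monom 1 (k * n X1) * (top_eval n u :: 'k poly)" for u
        using top_eval_x1[of "xpow X1 k" u] by (simp add: lookup_single)
      then have \<psi>h: "\<psi> h = smult c (monom 1 (k * n X1) * \<psi> (g \<rho>))"
        by (simp add: h_def \<psi>_def linext_single_mult) (simp add: linext_def sum_distrib_left)
      have "degree (\<psi> h) \<le> degree (\<psi> f)"
        using degree_mult_le[of "monom 1 (k * n X1)" "\<psi> (g \<rho>)"] k
        by (simp add: \<psi>h degree_monom_eq)
      moreover have "coeff (\<psi> h) (degree (\<psi> f)) = lead_coeff (\<psi> f)"
        using g0 by (simp add: \<psi>h k coeff_monom_mult c_def)
      moreover have \<psi>fh: "\<psi> (f - h) = \<psi> f - \<psi> h" by (simp add: \<psi>_def linext_diff)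
      ultimately have "degree (\<psi> (f - h)) < degree (\<psi> f) \<or> \<psi> (f - h) = 0"
        by (metis False coeff_diff degree_diff_le diff_self eq_zero_or_degree_less order.refl leading_coeff_0_iff le_less)
      moreover have "h \<in> L" "h \<in> L'" using gL gA L L' by (auto simp: h_def ideal_type_ring_iff)
      moreover have "f - h \<in> L" using ideal_diff[OF L less.prems] \<open>h \<in> L\<close> by blast
      ultimately have "f - h \<in> L'" using less.hyps L' by (auto simp: tangent_ideal_def \<psi>_def)
      then have "(f - h) + h \<in> L'" using \<open>h \<in> L'\<close> L' unfolding ideal_type_ring_iff by blast
      then show ?thesis by simp
    qed
  qed
  then show ?thesis using A by blast
qed

theorem CM_tangent_cone: "has_CM_tangent_cone (K :: 'k::field itself) n"
  unfolding has_CM_tangent_cone_def initial_ideal_eq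
proof (rule cohen_macaulay_quotient[OF tangent_ideal_is_ideal x1_part_zero_primeideal tangent_ideal_subset_x1_part_zero _ _ _
      x1_part_zero_nilpotent non_x1_part_zero_regular zero_dim_mod_tangent_ideal finitely_generated_mod_tangent_ideal])
  let ?M = "{f :: 'k pol. coeff (linext x1_eval f) 0 = 0}"
  show "ideal ?M pol_ring" by (simp add: ideal_type_ring_iff linext_add linext_x1_eval_mult coeff_mult_0)
  show "1 \<notin> ?M" by (simp add: linext_x1_eval_one)
  have "linext x1_eval (mono_pol (xpow X1 1) :: 'k pol) = monom 1 1" by (simp add: x1_eval_def lookup_single)
  then have "(mono_pol (xpow X1 1) :: 'k pol) \<in> ?M - x1_part_zero" by (simp add: x1_part_zero_def)
  moreover have "x1_part_zero \<subseteq> ?M" by (auto simp: x1_part_zero_def)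
  ultimately show "x1_part_zero \<subset> ?M" by blast
qed

end

section \<open>Critical exponents and indispensable monomials\<close>
lemma isolatedD: "isolated n M \<Longrightarrow> wt n M' = wt n M \<Longrightarrow> M' \<noteq> M \<Longrightarrow> expo M i = 0 \<or> expo M' i = 0"
  unfolding isolated_def by simp

text \<open>
  A multiple \<open>h f\<close> of a binomial \<open>f \<in> I(C)\<close> contains \<open>M\<close> only if a term of \<open>f\<close> divides \<open>M\<close>. If this
  term is not \<open>M\<close>, the same factor times the other term of \<open>f\<close> is a second monomial of the fibre that
  shares a variable with \<open>M\<close>. So without \<open>M\<close> as a term of a generator, no element of the ideal contains
  \<open>M\<close>, whereas \<open>M - P\<close> does.
\<close>
lemma isolated_indispensable:
  assumes iso: "isolated n M" and P: "wt n P = wt n M" "P \<noteq> M"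
  shows "indispensable (K :: 'k::field itself) n M"
  unfolding indispensable_def
proof (intro allI impI, rule ccontr)
  fix B :: "'k pol set"
  assume B: "(\<forall>f\<in>B. is_binomial f) \<and> genideal pol_ring B = curve_ideal K n"
    and no: "\<not> (\<exists>f\<in>B. M \<in> Poly_Mapping.keys f)"
  interpret T: cring "pol_ring :: 'k pol ring" by (rule cring_from_type_algebra)
  define T where "T = {f :: 'k pol. \<forall>h. Poly_Mapping.lookup (h * f) M = 0}"
  have T_ideal: "ideal T pol_ring"
    unfolding ideal_type_ring_iff T_def
    by (simp add: distrib_left lookup_add mult.assoc[symmetric])
  have "B \<subseteq> T"
  proof
    fix f assume f: "f \<in> B"
    then obtain p q where pq: "p \<noteq> q" "f = mono_pol p - mono_pol q"
      using B by (auto simp: is_binomial_def)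
    have "f \<in> curve_ideal K n" using f B T.genideal_self[of B] by auto
    then have w: "wt n p = wt n q" using pq by (simp add: binomial_in_curve_ideal)
    have "Poly_Mapping.keys f = {p, q}"
      using pq by (auto simp: in_keys_iff lookup_minus lookup_single when_def split: if_splits)
    then have M: "M \<noteq> p" "M \<noteq> q" and keys_f: "\<And>m. m \<in> Poly_Mapping.keys f \<Longrightarrow> m = p \<or> m = q"
      using no f by auto
    have not_multiple: "M \<noteq> t + m"
      if m: "M \<noteq> m" "wt n m' = wt n m" "m \<noteq> m'" for t m m' :: mon
    proof
      assume M_eq: "M = t + m"
      then have "t \<noteq> 0" using m by auto
      then obtain i where i: "expo t i \<noteq> 0" by (metis lookup_zero poly_mapping_eqI)
      have "t + m' \<noteq> M" using M_eq m by simp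
      moreover have "wt n (t + m') = wt n M" using M_eq m by simp
      ultimately have "expo M i = 0 \<or> expo (t + m') i = 0" using isolatedD[OF iso] by simp
      then show False using i M_eq by (simp add: lookup_add)
    qed
    have "Poly_Mapping.lookup (h * f) M = 0" for h
    proof (rule ccontr)
      assume "Poly_Mapping.lookup (h * f) M \<noteq> 0"
      then have "M \<in> Poly_Mapping.keys (h * f)" by (simp add: in_keys_iff)
      then obtain t m where "M = t + m" "m \<in> Poly_Mapping.keys f" using keys_mult[of h f] by blast
      then show False using keys_f not_multiple M w pq(1) by metis
    qed
    then show "f \<in> T" by (simp add: T_def)
  qed
  then have "genideal pol_ring B \<subseteq> T" by (rule T.genideal_minimal[OF T_ideal])
  then have "curve_ideal K n \<subseteq> T" using B by simp
  moreover have "(mono_pol M - mono_pol P :: 'k pol) \<in> curve_ideal K n"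
    using P by (simp add: binomial_in_curve_ideal)
  ultimately have "Poly_Mapping.lookup (1 * (mono_pol M - mono_pol P :: 'k pol)) M = 0"
    unfolding T_def by blast
  then show False using P by (simp add: lookup_minus lookup_single)
qed

lemma critical_binomialD:
  fixes u :: mon
  assumes "critical_binomial n i (mono_pol (xpow i (crit_exp n i)) - mono_pol u :: 'k::field pol)"
  shows "expo u i = 0" "wt n u = crit_exp n i * n i"
proof -
  obtain u' where u': "i \<notin> supp u'"
    "(mono_pol (xpow i (crit_exp n i)) - mono_pol u :: 'k pol) = mono_pol (xpow i (crit_exp n i)) - mono_pol u'"
    and mem: "(mono_pol (xpow i (crit_exp n i)) - mono_pol u :: 'k pol) \<in> curve_ideal TYPE('k) n"
    using assms unfolding critical_binomial_def by blast
  have "(mono_pol u :: 'k pol) = mono_pol u'" using u'(2) by simp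
  then have "u = u'" by (metis keys_single one_neq_zero singleton_inject)
  then show "expo u i = 0" using u'(1) by (simp add: in_keys_iff)
  show "wt n u = crit_exp n i * n i" using mem by (simp add: binomial_in_curve_ideal)
qed

lemma wt_remove: "wt n q = expo q i * n i + (\<Sum>j \<in> UNIV - {i}. expo q j * n j)"
  unfolding wt_def by (rule sum.remove) auto

text \<open>The set defining the critical exponent contains \<open>n\<^sub>j\<close>, since \<open>n\<^sub>j n\<^sub>i = n\<^sub>i n\<^sub>j\<close>.\<close>
lemma crit_exp_pos:
  assumes "\<And>j. 0 < n j" shows "0 < crit_exp n i"
proof -
  obtain j :: var where j: "j \<noteq> i" by (cases i) auto
  have "n j * n i = (\<Sum>k \<in> UNIV - {i}. (if k = j then n i else 0) * n k)"
    using j by (simp add: if_distrib[of "\<lambda>x. x * _"] cong: if_cong)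
  then have "\<exists>a. 0 < a \<and> (\<exists>g. a * n i = (\<Sum>j\<in>UNIV - {i}. g j * n j))"
    using assms[of j] by (intro exI[of _ "n j"] conjI exI[of _ "\<lambda>k. if k = j then n i else 0"])
  then show ?thesis unfolding crit_exp_def by (rule LeastI2_ex) simp
qed

lemma crit_exp_le:
  assumes "0 < b" "expo q i = 0" "wt n q = b * n i" shows "crit_exp n i \<le> b"
  unfolding crit_exp_def
proof (rule Least_le)
  have "b * n i = (\<Sum>j\<in>UNIV - {i}. expo q j * n j)" using assms wt_remove[of n q i] by simp
  then show "0 < b \<and> (\<exists>g. b * n i = (\<Sum>j\<in>UNIV - {i}. g j * n j))" using assms by blast
qed

lemma wt_in_shifted_semigroup:
  assumes "0 < expo P X1" "wt n P = wt n M" "expo M X1 = 0"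
  shows "expo M X2 * n X2 + expo M X3 * n X3 + expo M X4 * n X4 \<in> (+) (n X1) ` semigrp n"
proof -
  obtain P0 where P0: "P = xpow X1 1 + P0" using xpow_divides[of 1 P X1] assms(1) by auto
  have "wt n P0 \<in> semigrp n" unfolding semigrp_def wt_def by blast
  moreover have "expo M X2 * n X2 + expo M X3 * n X3 + expo M X4 * n X4 = n X1 + wt n P0"
    using assms P0 by (simp add: wt_def[of n M] sum_var)
  ultimately show ?thesis by (metis imageI)
qed

lemma x1_free_mon: "expo M X1 = 0 \<Longrightarrow> M = xpow X2 (expo M X2) + xpow X3 (expo M X3) + xpow X4 (expo M X4)"
proof (rule poly_mapping_eqI)
  fix i assume "expo M X1 = 0"
  then show "expo M i = expo (xpow X2 (expo M X2) + xpow X3 (expo M X3) + xpow X4 (expo M X4)) i"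
    by (cases i) (simp_all add: lookup_add lookup_single)
qed

theorem proposition2p6:
  fixes K :: "'k::field itself"
    and n :: "var \<Rightarrow> nat"
    and u v w z :: mon
  assumes pos: "0 < n X1"
    and incr: "n X1 < n X2" "n X2 < n X3" "n X3 < n X4"
    and gcd: "Gcd {n X1, n X2, n X3, n X4} = 1"
    and case1: "\<And>i j. i \<noteq> j \<Longrightarrow> crit_exp n i * n i \<noteq> crit_exp n j * n j"
    and crit:
      "critical_binomial n X1 (mono_pol (xpow X1 (crit_exp n X1)) - mono_pol u :: 'k pol)"
      "critical_binomial n X2 (mono_pol (xpow X2 (crit_exp n X2)) - mono_pol v :: 'k pol)"
      "critical_binomial n X3 (mono_pol (xpow X3 (crit_exp n X3)) - mono_pol w :: 'k pol)"
      "critical_binomial n X4 (mono_pol (xpow X4 (crit_exp n X4)) - mono_pol z :: 'k pol)"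
    and gen: "genideal pol_ring
        {mono_pol (xpow X1 (crit_exp n X1)) - mono_pol u,
         mono_pol (xpow X2 (crit_exp n X2)) - mono_pol v,
         mono_pol (xpow X3 (crit_exp n X3)) - mono_pol w,
         mono_pol (xpow X4 (crit_exp n X4)) - mono_pol z} = critical_ideal K n"
    and supp_v: "X1 \<notin> supp v"
    and cases:
      "(X1 \<in> supp w \<and> X1 \<in> supp z \<and>
        crit_exp n X3 \<le> mdeg w \<and>
        (\<forall>M N. mono_pol M - mono_pol N \<in> indisp_binomials K n \<and> X1 \<in> supp M \<longrightarrow> mdeg N \<le> mdeg M) \<and>
        (\<forall>M d2 d3 d4.
           M = xpow X2 d2 + xpow X3 d3 + xpow X4 d4 \<and>
           crit_exp n X2 \<le> d2 \<and> d3 < crit_exp n X3 \<and> d4 < crit_exp n X4 \<and>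
           d2 * n X2 + d3 * n X3 + d4 * n X4 \<in> (+) (n X1) ` semigrp n \<longrightarrow>
           (\<exists>N. X1 \<in> supp N \<and> mono_pol M - mono_pol N \<in> curve_ideal K n \<and> mdeg M \<le> mdeg N)))
       \<or>
       (X1 \<in> supp w \<and> X1 \<notin> supp z \<and>
        crit_exp n X3 \<le> mdeg w \<and>
        (\<forall>M d2 d3 d4.
           M = xpow X2 d2 + xpow X3 d3 + xpow X4 d4 \<and>
           d3 < crit_exp n X3 \<and>
           d2 * n X2 + d3 * n X3 + d4 * n X4 \<in> (+) (n X1) ` semigrp n \<longrightarrow>
           (\<exists>N. X1 \<in> supp N \<and> mono_pol M - mono_pol N \<in> curve_ideal K n \<and> mdeg M \<le> mdeg N)))
       \<or>
       (X1 \<notin> supp w \<and> X1 \<in> supp z \<and>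
        (\<forall>M d2 d3 d4.
           M = xpow X2 d2 + xpow X3 d3 + xpow X4 d4 \<and>
           d4 < crit_exp n X4 \<and>
           d2 * n X2 + d3 * n X3 + d4 * n X4 \<in> (+) (n X1) ` semigrp n \<longrightarrow>
           (\<exists>N. X1 \<in> supp N \<and> mono_pol M - mono_pol N \<in> curve_ideal K n \<and> mdeg M \<le> mdeg N)))"
  shows "has_CM_tangent_cone K n"
proof -
  define a where "a = crit_exp n"
  define r where "r i = (case i of X1 \<Rightarrow> u | X2 \<Rightarrow> v | X3 \<Rightarrow> w | X4 \<Rightarrow> z)" for i
  interpret positive_weights n using pos incr by unfold_locales
  have r: "expo (r i) i = 0" "wt n (r i) = a i * n i" for i
    using crit[THEN critical_binomialD(1)] crit[THEN critical_binomialD(2)]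
    by (cases i; simp add: r_def a_def)+
  interpret critical_monomials n a r
    using r crit_exp_pos[OF n_gt0] crit_exp_le by unfold_locales (auto simp: a_def)
  have r34: "r X3 = w" "r X4 = z" by (simp_all add: r_def)
  have x1_dominated_of_hyp: "x1_dominated n M"
    if "\<exists>N. X1 \<in> supp N \<and> (mono_pol M - mono_pol N :: 'k pol) \<in> curve_ideal K n \<and> mdeg M \<le> mdeg N" for M
    using that by (auto simp: x1_dominated_def in_supp binomial_in_curve_ideal)
  have x1_dominated: "x1_dominated n M" if M: "expo M X1 = 0" and P: "0 < expo P X1" "wt n P = wt n M" for M P
  proof -
    note shifted = wt_in_shifted_semigroup[OF _ _ M]
    note M_eq = x1_free_mon[OF M]
    consider
      (i) "X1 \<in> supp w" "X1 \<in> supp z" "crit_exp n X3 \<le> mdeg w"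
        "\<forall>M N. (mono_pol M - mono_pol N :: 'k pol) \<in> indisp_binomials K n \<and> X1 \<in> supp M \<longrightarrow> mdeg N \<le> mdeg M"
        "\<And>M d2 d3 d4. M = xpow X2 d2 + xpow X3 d3 + xpow X4 d4 \<Longrightarrow>
           crit_exp n X2 \<le> d2 \<Longrightarrow> d3 < crit_exp n X3 \<Longrightarrow> d4 < crit_exp n X4 \<Longrightarrow>
           d2 * n X2 + d3 * n X3 + d4 * n X4 \<in> (+) (n X1) ` semigrp n \<Longrightarrow>
           \<exists>N. X1 \<in> supp N \<and> (mono_pol M - mono_pol N :: 'k pol) \<in> curve_ideal K n \<and> mdeg M \<le> mdeg N"
    | (ii) "X1 \<in> supp w" "crit_exp n X3 \<le> mdeg w"
        "\<And>M d2 d3 d4. M = xpow X2 d2 + xpow X3 d3 + xpow X4 d4 \<Longrightarrow> d3 < crit_exp n X3 \<Longrightarrow>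
           d2 * n X2 + d3 * n X3 + d4 * n X4 \<in> (+) (n X1) ` semigrp n \<Longrightarrow>
           \<exists>N. X1 \<in> supp N \<and> (mono_pol M - mono_pol N :: 'k pol) \<in> curve_ideal K n \<and> mdeg M \<le> mdeg N"
    | (iii) "X1 \<in> supp z"
        "\<And>M d2 d3 d4. M = xpow X2 d2 + xpow X3 d3 + xpow X4 d4 \<Longrightarrow> d4 < crit_exp n X4 \<Longrightarrow>
           d2 * n X2 + d3 * n X3 + d4 * n X4 \<in> (+) (n X1) ` semigrp n \<Longrightarrow>
           \<exists>N. X1 \<in> supp N \<and> (mono_pol M - mono_pol N :: 'k pol) \<in> curve_ideal K n \<and> mdeg M \<le> mdeg N"
      using cases by (elim disjE conjE) blast+
    then show ?thesis
    proof cases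
      case i
      show ?thesis
      proof (rule x1_dominated_if_binomials_dominated[OF _ _ _ _ _ _ M P])
        show "a i * n i \<noteq> a j * n j" if "i \<noteq> j" for i j using case1 that by (simp add: a_def)
        show "0 < expo (r X3) X1" "a X3 \<le> mdeg (r X3)" "0 < expo (r X4) X1"
          using i by (simp_all add: r34 a_def in_supp)
      next
        fix l i j p q d e
        let ?P = "xpow X1 p + xpow l q" and ?M = "xpow i d + xpow j e"
        assume ij: "{X1, l, i, j} = UNIV" "i \<noteq> X1" "j \<noteq> X1"
          and h: "0 < p" "p < a X1" "0 < q" "q < a l" "0 < d" "0 < e"
          and wt: "wt n ?P = wt n ?M" and iso: "isolated n ?M"
        have "expo ?P X1 \<noteq> expo ?M X1" using ij h by (simp add: lookup_add lookup_single)
        then have "?P \<noteq> ?M" by metis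
        then have indisp: "indispensable K n ?M" by (rule isolated_indispensable[OF iso wt])
        have mem: "(mono_pol ?P - mono_pol ?M :: 'k pol) \<in> curve_ideal K n"
          using wt by (simp only: binomial_in_curve_ideal)
        have "(mono_pol ?P - mono_pol ?M :: 'k pol) \<in> indisp_binomials K n"
          unfolding indisp_binomials_def
          by (rule CollectI, rule exI[of _ X1], rule exI[of _ l], rule exI[of _ i], rule exI[of _ j],
              rule exI[of _ p], rule exI[of _ q], rule exI[of _ d], rule exI[of _ e],
              rule exI[of _ ?P], rule exI[of _ ?M])
            (use ij(1) h indisp mem in \<open>simp only: a_def simp_thms\<close>)
        moreover have "X1 \<in> supp ?P" using h(1) by (simp add: in_supp lookup_add)
        ultimately show "mdeg ?M \<le> mdeg ?P" using i(4) by blast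
      next
        fix M P assume h: "expo M X1 = 0" "a X2 \<le> expo M X2" "expo M X3 < a X3" "expo M X4 < a X4"
          "0 < expo P X1" "wt n P = wt n M"
        show "x1_dominated n M"
          using i(5)[OF x1_free_mon _ _ _ wt_in_shifted_semigroup, of M P] h
          by (intro x1_dominated_of_hyp) (simp add: a_def)
      qed
    next
      case ii
      show ?thesis
      proof (cases "a X3 \<le> expo M X3")
        case True
        then show ?thesis using x1_dominated_of_replacement[of X3 M] ii by (simp add: r34 a_def in_supp)
      next
        case False
        then show ?thesis using ii(3)[OF M_eq _ shifted[OF P]] by (intro x1_dominated_of_hyp) (simp add: a_def)
      qed
    next
      case iii
      show ?thesis
      proof (cases "a X4 \<le> expo M X4")
        case True
        then show ?thesis using x1_dominated_of_replacement[of X4 M] iii mdeg_r4 by (simp add: r34 a_def in_supp)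
      next
        case False
        then show ?thesis using iii(2)[OF M_eq _ shifted[OF P]] by (intro x1_dominated_of_hyp) (simp add: a_def)
      qed
    qed
  qed
  interpret all_x1_dominated n using x1_dominated by unfold_locales
  show ?thesis by (rule CM_tangent_cone)
qed

end
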